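(* Consider the linear time-varying system $\dot x=A(t)x$, $t\ge t_0$, on $\mathbb{R}^n$, with $A=[a_{ij}]:\mathbb{R}\to\mathbb{R}^{n\times n}$ piecewise continuous. Let $\mu$ be the matrix measure associated with an induced norm on $\mathbb{R}^{n\times n}$. Then the topological entropy $h(A)$ of the system satisfies $$h(A)\le n\max\Big\{\limsup_{t\to\infty}\mu(A(t)),\,0\Big\}\qquad\text{and}\qquad h(A)\ge\max\Big\{\liminf_{t\to\infty}\operatorname{tr}(A(t)),\,0\Big\}.$$ Moreover, suppose there is a Metzler matrix $\hat A=[\hat a_{ij}]\in\mathbb{R}^{n\times n}$ such that $$\hat a_{ii}\ge\limsup_{t\to\infty}a_{ii}(t),\qquad\hat a_{ij}\ge\limsup_{t\to\infty}|a_{ij}(t)|\qquad\text{for all } i,j\in\{1,\dots,n\},\ i\ne j.$$ Then $$h(A)\le n\max\{\lambda_{\max}(\hat A),\,0\}.$$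
   Context: Matrix measure: for an induced norm $\|\cdot\|$ on $\mathbb{R}^{n\times n}$, $\mu(A):=\lim_{t\searrow0}\frac{\|I+tA\|-1}{t}$. A Metzler matrix is a real square matrix with nonnegative off-diagonal entries; $\lambda_{\max}(M)$ denotes its eigenvalue with the largest real part (which is real). Topological entropy: let $\xi(t,t_0,x)$ be the solution of $\dot x=A(t)x$ at time $t$ with state $x$ at time $t_0$, let $K\subset\mathbb{R}^n$ be a compact set with nonempty interior, and fix a norm $|\cdot|$ on $\mathbb{R}^n$. For $T\ge0$, $\varepsilon>0$, a subset $E\subset K$ is $(T,\varepsilon)$-spanning if for every $\bar x\in K$ there is $x\in E$ with $|\xi(t,t_0,\bar x)-\xi(t,t_0,x)|<\varepsilon$ for all $t\in[t_0,t_0+T]$; $S(\varepsilon,T)$ is the minimal cardinality of a $(T,\varepsilon)$-spanning set. The entropy is $\lim_{\varepsilon\searrow0}\limsup_{T\to\infty}\frac1T\log S(\varepsilon,T)$ (natural logarithm). For linear time-varying systems it is independent of the norm, of the initial set $K$, and of the initial time $t_0$, and is denoted $h(A)$. *)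

theory Defs
  imports "HOL-Analysis.Analysis"
begin

definition piecewise_continuous :: "(real \<Rightarrow> 'a::topological_space) \<Rightarrow> bool" where
  "piecewise_continuous f \<longleftrightarrow>
     (\<forall>a b. finite {t \<in> {a..b}. \<not> isCont f t}) \<and>
     (\<forall>t. (\<exists>l. (f \<longlongrightarrow> l) (at_left t)) \<and> (\<exists>r. (f \<longlongrightarrow> r) (at_right t)))"

definition is_norm :: "('a::real_vector \<Rightarrow> real) \<Rightarrow> bool" where
  "is_norm N \<longleftrightarrow>
     (\<forall>x. 0 \<le> N x) \<and>
     (\<forall>x. N x = 0 \<longleftrightarrow> x = 0) \<and>
     (\<forall>c x. N (c *\<^sub>R x) = \<bar>c\<bar> * N x) \<and>
     (\<forall>x y. N (x + y) \<le> N x + N y)"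

definition induced_norm :: "(real^'n \<Rightarrow> real) \<Rightarrow> real^'n^'n \<Rightarrow> real" where
  "induced_norm N M = (SUP x \<in> {x. x \<noteq> 0}. N (M *v x) / N x)"

definition matrix_measure :: "(real^'n^'n \<Rightarrow> real) \<Rightarrow> real^'n^'n \<Rightarrow> real" where
  "matrix_measure nrm M = Lim (at_right 0) (\<lambda>t. (nrm (mat 1 + t *\<^sub>R M) - 1) / t)"

definition metzler :: "real^'n^'n \<Rightarrow> bool" where
  "metzler M \<longleftrightarrow> (\<forall>i j. i \<noteq> j \<longrightarrow> 0 \<le> M $ i $ j)"

definition complex_eigenvalue :: "real^'n^'n \<Rightarrow> complex \<Rightarrow> bool" where
  "complex_eigenvalue M z \<longleftrightarrow>
     (\<exists>v. v \<noteq> 0 \<and> (\<chi> i j. complex_of_real (M $ i $ j)) *v v = z *s v)"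

(* The eigenvalue with the largest real part, among all complex eigenvalues. Such a real number
   exists for Metzler matrices by Perron-Frobenius; the value is meaningless for matrices whose
   rightmost eigenvalues are all non-real. *)
definition lambda_max :: "real^'n^'n \<Rightarrow> real" where
  "lambda_max M = (THE l. complex_eigenvalue M (complex_of_real l) \<and>
                          (\<forall>z. complex_eigenvalue M z \<longrightarrow> Re z \<le> l))"

(* Solutions for a piecewise continuous coefficient matrix: continuous functions satisfying the
   differential equation wherever A is continuous (one-sidedly at the initial time). *)
definition is_solution ::
  "(real \<Rightarrow> real^'n^'n) \<Rightarrow> real \<Rightarrow> real^'n \<Rightarrow> (real \<Rightarrow> real^'n) \<Rightarrow> bool" where
  "is_solution A t0 x f \<longleftrightarrow>
     continuous_on {t0..} f \<and> f t0 = x \<and>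
     (\<forall>t\<ge>t0. isCont A t \<longrightarrow> (f has_vector_derivative A t *v f t) (at t within {t0..}))"

(* flow A t t0 x is the state at time t \<ge> t0; on {t0..} the solution is unique, so the
   choice operator only affects the irrelevant values at t < t0. *)
definition flow :: "(real \<Rightarrow> real^'n^'n) \<Rightarrow> real \<Rightarrow> real \<Rightarrow> real^'n \<Rightarrow> real^'n" where
  "flow A t t0 x = (SOME f. is_solution A t0 x f) t"

definition spanning_set ::
  "(real^'n \<Rightarrow> real) \<Rightarrow> (real^'n) set \<Rightarrow> real \<Rightarrow> (real \<Rightarrow> real^'n^'n)
     \<Rightarrow> real \<Rightarrow> real \<Rightarrow> (real^'n) set \<Rightarrow> bool" where
  "spanning_set N K t0 A T \<epsilon> E \<longleftrightarrow>
     E \<subseteq> K \<and>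
     (\<forall>y\<in>K. \<exists>x\<in>E. \<forall>t\<in>{t0..t0 + T}. N (flow A t t0 y - flow A t t0 x) < \<epsilon>)"

(* Finite spanning sets exist for compact K; finiteness is required because card is 0 on
   infinite sets. *)
definition min_spanning_card ::
  "(real^'n \<Rightarrow> real) \<Rightarrow> (real^'n) set \<Rightarrow> real \<Rightarrow> (real \<Rightarrow> real^'n^'n)
     \<Rightarrow> real \<Rightarrow> real \<Rightarrow> nat" where
  "min_spanning_card N K t0 A \<epsilon> T =
     (LEAST k. \<exists>E. finite E \<and> card E = k \<and> spanning_set N K t0 A T \<epsilon> E)"

definition topological_entropy ::
  "(real^'n \<Rightarrow> real) \<Rightarrow> (real^'n) set \<Rightarrow> real \<Rightarrow> (real \<Rightarrow> real^'n^'n) \<Rightarrow> ereal" where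
  "topological_entropy N K t0 A =
     Lim (at_right (0::real)) (\<lambda>\<epsilon>.
       Limsup at_top (\<lambda>T. ereal (1 / T * ln (real (min_spanning_card N K t0 A \<epsilon> T)))))"

end

(*
  Let X(t) be the fundamental matrix of the system. If a set is (T, e)-spanning, then the image of K
  under X(t0 + T) is covered by as many e-balls as the set has points. By Liouville's formula that
  image has volume vol(K) * exp(integral of tr A), whence the lower bound. Conversely, if |X(t)| grows
  at most like exp(c t) with c >= 0, then the points of a grid of mesh comparable to e * exp(-c T) are
  (T, e)-spanning, and about exp(n c T) of them suffice, so h(A) <= n c.

  Such a growth bound in a norm N holds as soon as N(y + h A(t) y) <= (1 + c h) N(y) for small h > 0
  and all large t. If limsup mu(A(t)) < c, this is true for the norm defining mu. In the Metzler case
  and for c > lambda_max, a strictly positive Perron vector v of a positive perturbation of the Metzler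
  matrix satisfies B v < c v, and the maximum norm weighted by v will do.
*)

theory Submission
  imports Defs
begin

subsection \<open>Norms on Euclidean space\<close>

text \<open>Since \<open>A\<close> may jump, a solution is differentiable only off finitely many
  times of each bounded window, and a norm along it need not be differentiable at all. Growth is
  therefore controlled by a one-sided infinitesimal inequality plus continuity. The objects are
  given by \<open>Lim\<close>, \<open>SOME\<close>, \<open>LEAST\<close>, \<open>THE\<close> and a
  real \<open>SUP\<close>, so each needs a fact that pins it down: monotonicity in the scale, a
  convergent Picard series, finite nets, limits of Perron roots, equivalence of norms. The maximum
  with 0 is there because spanning compares trajectories on the whole window, its start included:
  later contraction saves nothing. What \<open>A\<close> does before some fixed time changes only
  constants, which the factor \<open>1 / T\<close> removes. The limits are approached through reals
  strictly beyond them, which leaves room for a perturbation. In the Metzler case the Perron vector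
  of the matrix itself may have zero entries and is then no weight vector. Adding a small \<delta>
  to every entry makes it positive, and the same \<delta> is the slack by which the entries of
  \<open>A t\<close> may exceed their bounds.\<close>

lemma is_norm_norm: "is_norm (norm :: 'a::real_normed_vector \<Rightarrow> real)"
  by (auto simp: is_norm_def norm_triangle_ineq)

context
  fixes N :: "'a::euclidean_space \<Rightarrow> real"
  assumes N: "is_norm N"
begin

lemma is_norm_nonneg: "0 \<le> N x"
  using N by (auto simp: is_norm_def)

lemma is_norm_eq_0: "N x = 0 \<longleftrightarrow> x = 0"
  using N by (auto simp: is_norm_def)

lemma is_norm_pos: "x \<noteq> 0 \<Longrightarrow> 0 < N x"
  using is_norm_nonneg[of x] is_norm_eq_0[of x] by linarith

lemma is_norm_scaleR: "N (c *\<^sub>R x) = \<bar>c\<bar> * N x"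
  using N by (auto simp: is_norm_def)

lemma is_norm_triangle: "N (x + y) \<le> N x + N y"
  using N by (auto simp: is_norm_def)

lemma is_norm_minus: "N (- x) = N x"
  using is_norm_scaleR[of "-1" x] by simp

lemma is_norm_diff: "\<bar>N x - N y\<bar> \<le> N (x - y)"
  using is_norm_triangle[of "x - y" y] is_norm_triangle[of "y - x" x] is_norm_minus[of "x - y"]
  by simp

lemma is_norm_sum: "N (sum f S) \<le> (\<Sum>i\<in>S. N (f i))"
proof (induction S rule: infinite_finite_induct)
  case (insert x F)
  then show ?case
    using is_norm_triangle[of "f x" "sum f F"] by simp
qed (use is_norm_eq_0[of 0] in auto)

lemma is_norm_upper: obtains C where "C > 0" "\<And>x. N x \<le> C * norm x"
proof
  let ?C = "(\<Sum>b\<in>Basis. N b) + 1"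
  have s: "0 \<le> (\<Sum>b\<in>Basis. N b)"
    by (simp add: is_norm_nonneg sum_nonneg)
  then show "?C > 0"
    by simp
  show "N x \<le> ?C * norm x" for x
  proof -
    have "N x = N (\<Sum>b\<in>Basis. (x \<bullet> b) *\<^sub>R b)"
      by (simp add: euclidean_representation)
    also have "\<dots> \<le> (\<Sum>b\<in>Basis. \<bar>x \<bullet> b\<bar> * N b)"
      using is_norm_sum[of "\<lambda>b. (x \<bullet> b) *\<^sub>R b" Basis] by (simp add: is_norm_scaleR)
    also have "\<dots> \<le> (\<Sum>b\<in>Basis. norm x * N b)"
      by (intro sum_mono mult_right_mono) (auto simp: is_norm_nonneg Basis_le_norm)
    also have "\<dots> \<le> ?C * norm x"
      by (simp add: distrib_left mult.commute[of _ "norm x"] flip: sum_distrib_left)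
    finally show ?thesis .
  qed
qed

lemma is_norm_tendsto:
  assumes "(f \<longlongrightarrow> l) F"
  shows "((\<lambda>x. N (f x)) \<longlongrightarrow> N l) F"
proof -
  obtain C where C: "C > 0" "\<And>x. N x \<le> C * norm x"
    using is_norm_upper by blast
  have "((\<lambda>x. C * norm (f x - l)) \<longlongrightarrow> C * norm (l - l)) F"
    by (intro tendsto_intros assms)
  then have z: "((\<lambda>x. C * norm (f x - l)) \<longlongrightarrow> 0) F"
    by simp
  have "\<forall>\<^sub>F x in F. norm (N (f x) - N l) \<le> C * norm (f x - l)"
    using is_norm_diff C(2) by (intro always_eventually allI) (metis order_trans real_norm_def)
  from Lim_null_comparison[OF this z] show ?thesis
    by (simp add: LIM_zero_iff)
qed

lemma is_norm_continuous_on: "continuous_on S f \<Longrightarrow> continuous_on S (\<lambda>x. N (f x))"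
  unfolding continuous_on_def using is_norm_tendsto by blast

text \<open>With \<open>is_norm_upper\<close> this is the equivalence of norms in finite dimension:
  \<open>N\<close> attains a positive minimum on the compact unit sphere, and homogeneity does the
  rest.\<close>

lemma is_norm_lower: obtains c where "c > 0" "\<And>x. c * norm x \<le> N x"
proof -
  have ne: "sphere (0::'a) 1 \<noteq> {}"
    by simp
  have "continuous_on (sphere 0 1) N"
    using is_norm_continuous_on[of _ "\<lambda>x. x"] by simp
  then obtain x0 where x0: "x0 \<in> sphere 0 1" "\<forall>x\<in>sphere 0 1. N x0 \<le> N x"
    using continuous_attains_inf[OF compact_sphere ne] by blast
  show ?thesis
  proof (rule that[of "N x0"])
    show "N x0 > 0"
      using x0 is_norm_pos[of x0] by force
    show "N x0 * norm x \<le> N x" for x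
    proof (cases "x = 0")
      case False
      then have "N x0 \<le> N ((1 / norm x) *\<^sub>R x)"
        using x0 by simp
      also have "\<dots> = N x / norm x"
        unfolding is_norm_scaleR by simp
      finally show ?thesis
        using False by (simp add: field_simps)
    qed (simp add: is_norm_nonneg)
  qed
qed

end

subsection \<open>Growth of solutions\<close>

text \<open>The exceptional points are absorbed by letting the comparison function jump by
  \<open>e\<close> at each of them; this is possible because \<open>g\<close> is continuous.\<close>

lemma dini_nonincreasing:
  fixes g :: "real \<Rightarrow> real"
  assumes ab: "a \<le> b" and cont: "continuous_on {a..b} g" and S: "finite S"
    and dini: "\<And>t e. t \<in> {a..<b} - S \<Longrightarrow> 0 < e \<Longrightarrow> \<forall>\<^sub>F h in at_right 0. g (t + h) \<le> g t + e * h"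
  shows "g b \<le> g a"
proof -
  have step: "g b \<le> g a + e * (b - a) + e * real (card S)" if e: "e > 0" for e
  proof -
    \<comment> \<open>The slope \<open>e\<close> pays for the Dini condition. The strict
      \<open>s < t\<close> makes each jump take effect just after its exceptional point, where it is
      needed.\<close>
    define \<phi> where "\<phi> t = g a + e * (t - a) + e * real (card {s\<in>S. s < t})" for t
    have mono: "\<phi> s + e * (t - s) \<le> \<phi> t" if "s \<le> t" for s t
    proof -
      have "card {r\<in>S. r < s} \<le> card {r\<in>S. r < t}"
        using S that by (intro card_mono) auto
      then show ?thesis
        using e by (simp add: \<phi>_def algebra_simps)
    qed
    have jump: "\<phi> s + e \<le> \<phi> t" if "s < t" "s \<in> S" for s t
    proof -
      have "Suc (card {r\<in>S. r < s}) = card (insert s {r\<in>S. r < s})"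
        using S by simp
      also have "\<dots> \<le> card {r\<in>S. r < t}"
        using S that by (intro card_mono) auto
      finally have "real (card {r\<in>S. r < s}) + 1 \<le> real (card {r\<in>S. r < t})"
        by linarith
      then have "e * (real (card {r\<in>S. r < s}) + 1) \<le> e * real (card {r\<in>S. r < t})"
        using e by (intro mult_left_mono) auto
      moreover have "e * (s - a) \<le> e * (t - a)"
        using e that by (intro mult_left_mono) auto
      ultimately show ?thesis
        by (simp add: \<phi>_def algebra_simps)
    qed
    \<comment> \<open>Continuation argument: \<open>Sup P\<close> is the last time up to which
      \<phi> dominates \<open>g\<close>, and it will turn out to be \<open>b\<close>.\<close>
    define P where "P = {t\<in>{a..b}. \<forall>u\<in>{a..t}. g u \<le> \<phi> u}"
    have aP: "a \<in> P"
      using ab e by (auto simp: P_def \<phi>_def)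
    have bdd: "bdd_above P"
      by (rule bdd_aboveI[of _ b]) (auto simp: P_def)
    define c where "c = Sup P"
    have "P \<subseteq> {a..b}"
      by (auto simp: P_def)
    then have cb: "a \<le> c" "c \<le> b"
      unfolding c_def using aP by (auto intro!: cSup_upper[OF _ bdd] cSup_least)
    have below: "g u \<le> \<phi> u" if u: "a \<le> u" "u < c" for u
    proof -
      obtain t where "t \<in> P" "u < t"
        using u aP less_cSupD[of P u] unfolding c_def by blast
      then show ?thesis
        using u by (auto simp: P_def)
    qed
    \<comment> \<open>The bound passes to the limit from the left: \<open>g\<close> is continuous,
      and \<phi>, although discontinuous, is monotone, so \<open>\<phi> c\<close> dominates all
      earlier values.\<close>
    have gc: "g c \<le> \<phi> c"
    proof (cases "a = c")
      case True
      then show ?thesis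
        using e by (auto simp: \<phi>_def)
    next
      case False
      then have "a < c"
        using cb by simp
      have "(g \<longlongrightarrow> g c) (at c within {a..b})"
        using cont cb by (auto simp: continuous_on_def)
      then have lim: "(g \<longlongrightarrow> g c) (at c within {a..<c})"
        by (rule tendsto_within_subset) (use cb in auto)
      have "at c within {a..<c} = at_left c"
        using \<open>a < c\<close> by (intro at_within_nhd[of _ "{a<..}"]) auto
      then have nt: "at c within {a..<c} \<noteq> bot"
        by simp
      show ?thesis
      proof (rule tendsto_upperbound[OF lim _ nt])
        show "\<forall>\<^sub>F u in at c within {a..<c}. g u \<le> \<phi> c"
          unfolding eventually_at_filter
        proof (intro always_eventually allI impI)
          fix u assume "u \<noteq> c" "u \<in> {a..<c}"
          moreover have "0 \<le> e * (c - u)"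
            using e \<open>u \<in> {a..<c}\<close> by simp
          ultimately show "g u \<le> \<phi> c"
            using below[of u] mono[of u c] by auto
        qed
      qed
    qed
    \<comment> \<open>Otherwise the bound extends beyond \<open>c\<close>: off \<open>S\<close> by
      the Dini condition, and at a point of \<open>S\<close> because \<phi> has jumped by
      \<open>e\<close> while \<open>g\<close> has moved by less than \<open>e\<close>.\<close>
    have "c = b"
    proof (rule ccontr)
      assume "c \<noteq> b"
      then have cb': "c < b"
        using cb by simp
      have "\<forall>\<^sub>F h in at_right 0. g (c + h) \<le> \<phi> (c + h)"
      proof (cases "c \<in> S")
        case False
        then have "\<forall>\<^sub>F h in at_right 0. g (c + h) \<le> g c + e * h"
          using dini[of c e] cb cb' e by auto
        moreover have "\<forall>\<^sub>F h in at_right 0. (0::real) < h"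
          by (simp add: eventually_at_right_less)
        ultimately show ?thesis
        proof eventually_elim
          case (elim h)
          then show ?case
            using gc mono[of c "c + h"] by simp
        qed
      next
        case True
        have "(g \<longlongrightarrow> g c) (at c within {a..b})"
          using cont cb by (auto simp: continuous_on_def)
        then have "(g \<longlongrightarrow> g c) (at c within {c<..<b})"
          by (rule tendsto_within_subset) (use cb in auto)
        moreover have "at c within {c<..<b} = at_right c"
          using cb' by (intro at_within_nhd[of _ "{..<b}"]) auto
        ultimately have "(g \<longlongrightarrow> g c) (at_right c)"
          by simp
        then have "\<forall>\<^sub>F u in at_right c. g u < g c + e"
          using e by (intro order_tendstoD(2)) auto
        moreover have "\<forall>\<^sub>F u in at_right c. c < u"
          by (simp add: eventually_at_right_less)
        ultimately have "\<forall>\<^sub>F u in at_right c. g u \<le> \<phi> u"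
        proof eventually_elim
          case (elim u)
          then show ?case
            using gc jump[of c u] True by simp
        qed
        then show ?thesis
          by (subst (asm) at_right_to_0) (simp add: eventually_filtermap add.commute)
      qed
      then obtain d where d: "d > 0" "\<And>h. 0 < h \<Longrightarrow> h < d \<Longrightarrow> g (c + h) \<le> \<phi> (c + h)"
        unfolding eventually_at_right_field by auto
      define t where "t = min b (c + d / 2)"
      have t: "c < t" "t \<le> b"
        using d cb' by (auto simp: t_def)
      have "t \<in> P"
        unfolding P_def
      proof (intro CollectI conjI ballI)
        show "t \<in> {a..b}"
          using t cb by auto
        fix u assume u: "u \<in> {a..t}"
        consider "u < c" | "u = c" | "c < u"
          by linarith
        then show "g u \<le> \<phi> u"
        proof cases
          case 3
          then show ?thesis
            using d(2)[of "u - c"] u d(1) by (auto simp: t_def)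
        qed (use below u gc in auto)
      qed
      then show False
        using cSup_upper[OF _ bdd, of t] t by (simp add: c_def)
    qed
    then have "g b \<le> \<phi> b"
      using gc by simp
    moreover have "card {s\<in>S. s < b} \<le> card S"
      using S by (intro card_mono) auto
    then have "e * real (card {s\<in>S. s < b}) \<le> e * real (card S)"
      using e by simp
    ultimately show ?thesis
      by (simp add: \<phi>_def)
  qed
  have lim: "((\<lambda>e. g a + e * (b - a) + e * real (card S)) \<longlongrightarrow> g a + 0 * (b - a) + 0 * real (card S))
    (at_right 0)"
    by (intro tendsto_intros)
  have "g b \<le> g a + 0 * (b - a) + 0 * real (card S)"
  proof (rule tendsto_lowerbound[OF lim])
    show "\<forall>\<^sub>F e in at_right 0. g b \<le> g a + e * (b - a) + e * real (card S)"
      using eventually_at_right_less[of 0] by eventually_elim (rule step)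
  qed simp
  then show ?thesis
    by simp
qed

text \<open>A Gronwall inequality for an arbitrary norm: after multiplication by
  \<open>exp (- c * t)\<close> the norm of \<open>f\<close> satisfies the Dini condition, because
  \<open>1 + c * h \<le> exp (c * h)\<close> and the remainder of the derivative is
  \<open>o(h)\<close>.\<close>

lemma norm_growth:
  fixes f :: "real \<Rightarrow> 'a::euclidean_space"
  assumes N: "is_norm N" and ab: "a \<le> b" and cont: "continuous_on {a..b} f" and S: "finite S"
    and der: "\<And>t. t \<in> {a..<b} - S \<Longrightarrow> (f has_vector_derivative D t) (at t within {a..b})"
    and le: "\<And>t. t \<in> {a..<b} - S \<Longrightarrow>
      \<forall>\<^sub>F h in at_right 0. N (f t + h *\<^sub>R D t) \<le> (1 + c * h) * N (f t)"
  shows "N (f b) \<le> exp (c * (b - a)) * N (f a)"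
proof -
  define g where "g t = exp (- c * t) * N (f t)" for t
  have "g b \<le> g a"
  proof (rule dini_nonincreasing[OF ab _ S])
    show "continuous_on {a..b} g"
      unfolding g_def by (intro continuous_intros is_norm_continuous_on[OF N] cont)
    fix t e :: real
    assume t: "t \<in> {a..<b} - S" and e: "0 < e"
    define r where "r h = (f (t + h) - f t - h *\<^sub>R D t) /\<^sub>R h" for h
    have "((\<lambda>u. (f u - f t - (u - t) *\<^sub>R D t) /\<^sub>R norm (u - t)) \<longlongrightarrow> 0) (at t within {a..b})"
      using der[OF t]
      by (simp add: has_vector_derivative_def has_derivative_at_within divide_inverse mult.commute)
    then have "((\<lambda>u. (f u - f t - (u - t) *\<^sub>R D t) /\<^sub>R norm (u - t)) \<longlongrightarrow> 0) (at t within {t<..<b})"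
      by (rule tendsto_within_subset) (use t in auto)
    moreover have "at t within {t<..<b} = at_right t"
      using t by (intro at_within_nhd[of _ "{..<b}"]) auto
    ultimately have "((\<lambda>u. (f u - f t - (u - t) *\<^sub>R D t) /\<^sub>R norm (u - t)) \<longlongrightarrow> 0) (at_right t)"
      by simp
    then have "((\<lambda>h. (f (t + h) - f t - h *\<^sub>R D t) /\<^sub>R norm h) \<longlongrightarrow> 0) (at_right 0)"
      by (subst (asm) at_right_to_0) (simp add: filterlim_filtermap add.commute)
    then have "(r \<longlongrightarrow> 0) (at_right 0)"
    proof (rule Lim_transform_eventually)
      show "\<forall>\<^sub>F h in at_right 0. (f (t + h) - f t - h *\<^sub>R D t) /\<^sub>R norm h = r h"
        using eventually_at_right_less[of 0] by eventually_elim (simp add: r_def)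
    qed
    then have "((\<lambda>h. exp (- c * (t + h)) * N (r h)) \<longlongrightarrow> exp (- c * (t + 0)) * N 0) (at_right 0)"
      by (intro tendsto_intros is_norm_tendsto[OF N])
    then have "\<forall>\<^sub>F h in at_right 0. exp (- c * (t + h)) * N (r h) < e"
      using e is_norm_eq_0[OF N, of 0] by (intro order_tendstoD(2)) auto
    then show "\<forall>\<^sub>F h in at_right 0. g (t + h) \<le> g t + e * h"
      using eventually_at_right_less[of 0] le[OF t]
    proof eventually_elim
      case (elim h)
      have "f (t + h) = (f t + h *\<^sub>R D t) + h *\<^sub>R r h"
        using elim by (simp add: r_def)
      then have "N (f (t + h)) \<le> N (f t + h *\<^sub>R D t) + h * N (r h)"
        using is_norm_triangle[OF N] is_norm_scaleR[OF N, of h "r h"] elim by (metis abs_of_pos)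
      also have "\<dots> \<le> exp (c * h) * N (f t) + h * N (r h)"
        using elim mult_right_mono[OF exp_ge_add_one_self is_norm_nonneg[OF N], of "c * h" "f t"]
        by simp
      finally have "g (t + h) \<le> exp (- c * (t + h)) * (exp (c * h) * N (f t) + h * N (r h))"
        by (simp add: g_def)
      also have "\<dots> = g t + h * (exp (- c * (t + h)) * N (r h))"
        by (simp add: g_def algebra_simps mult_exp_exp)
      also have "\<dots> \<le> g t + h * e"
        using elim by simp
      finally show ?case
        by (simp add: mult.commute)
    qed
  qed
  then have "exp (c * b) * (exp (- c * b) * N (f b)) \<le> exp (c * b) * (exp (- c * a) * N (f a))"
    by (simp add: g_def)
  then show ?thesis
    by (simp add: mult_exp_exp algebra_simps flip: mult.assoc)
qed

subsection \<open>Existence and uniqueness of solutions\<close>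

lemma bounded_bilinear_matrix_vector:
  "bounded_bilinear ((*v) :: real^'n^'m \<Rightarrow> real^'n \<Rightarrow> real^'m)"
  unfolding bilinear_conv_bounded_bilinear [symmetric] bilinear_def
  by (auto intro!: linearI simp: matrix_vector_right_distrib matrix_vector_mult_add_rdistrib
      matrix_vector_mult_scaleR simp flip: scaleR_matrix_vector_assoc)

context
  fixes A :: "real \<Rightarrow> real^'n^'n"
  assumes A: "piecewise_continuous A"
begin

definition jumps :: "real \<Rightarrow> real \<Rightarrow> real set" where
  "jumps a b = {t\<in>{a..b}. \<not> isCont A t}"

lemma finite_jumps: "finite (jumps a b)"
  using A by (simp add: jumps_def piecewise_continuous_def)

text \<open>The one-sided limits bound \<open>A\<close> near each point, the value at the point
  being counted separately; bisection passes from local to global boundedness without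
  continuity.\<close>

lemma pc_bounded: obtains L where "\<And>t. t \<in> {a..b} \<Longrightarrow> norm (A t) \<le> L"
proof (cases "a \<le> b")
  case True
  have "\<exists>L. \<forall>t\<in>{a..b}. norm (A t) \<le> L"
    using True
  proof (induction rule: Bolzano)
    case (trans a b c)
    then obtain L1 L2 where "\<forall>t\<in>{a..b}. norm (A t) \<le> L1" "\<forall>t\<in>{b..c}. norm (A t) \<le> L2"
      by blast
    then have "\<forall>t\<in>{a..c}. norm (A t) \<le> max L1 L2"
      by (metis atLeastAtMost_iff le_max_iff_disj linear)
    then show ?case
      by blast
  next
    case (local x)
    obtain l r where l: "(A \<longlongrightarrow> l) (at_left x)" and r: "(A \<longlongrightarrow> r) (at_right x)"
      using A unfolding piecewise_continuous_def by blast
    define L where "L = norm l + norm r + norm (A x) + 1"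
    have "\<forall>\<^sub>F t in at_left x. norm (A t) < L"
      by (intro order_tendstoD(2)[OF tendsto_norm[OF l]]) (simp add: L_def add_nonneg_pos)
    moreover have "\<forall>\<^sub>F t in at_right x. norm (A t) < L"
      by (intro order_tendstoD(2)[OF tendsto_norm[OF r]])
        (use norm_ge_zero[of l] norm_ge_zero[of "A x"] in \<open>unfold L_def, linarith\<close>)
    ultimately have "\<forall>\<^sub>F t in at x. norm (A t) < L"
      by (simp add: eventually_at_split)
    then obtain d where d: "d > 0" "\<And>t. t \<noteq> x \<Longrightarrow> dist t x < d \<Longrightarrow> norm (A t) < L"
      unfolding eventually_at by auto
    have "norm (A t) \<le> L" if "dist t x < d" for t
      using d(2)[of t] that norm_ge_zero[of l] norm_ge_zero[of r] by (cases "t = x") (auto simp: L_def)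
    then have "\<forall>a b. a \<le> x \<and> x \<le> b \<and> b - a < d \<longrightarrow> (\<forall>t\<in>{a..b}. norm (A t) \<le> L)"
      by (auto simp: dist_real_def)
    then show ?case
      using d(1) by blast
  qed
  then show ?thesis
    using that by blast
qed (use that in auto)

section \<open>Measurability and integrability of the coefficient matrix\<close>

lemma pc_borel_measurable: "A \<in> borel_measurable borel"
proof (rule borel_measurable_continuous_countable_exceptions)
  let ?X = "\<Union>n::nat. jumps (- real n) (real n)"
  show "countable ?X"
    by (simp add: finite_jumps countable_finite)
  show "continuous_on (- ?X) A"
  proof (intro continuous_at_imp_continuous_on ballI)
    fix t assume t: "t \<in> - ?X"
    obtain n :: nat where "\<bar>t\<bar> \<le> real n"
      using real_arch_simple by blast
    then have "t \<in> {- real n..real n}"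
      by auto
    then show "isCont A t"
      using t by (auto simp: jumps_def)
  qed
qed

lemma pc_integrable: "A integrable_on {a..b}"
proof -
  obtain L where L: "\<And>t. t \<in> {a..b} \<Longrightarrow> norm (A t) \<le> L"
    using pc_bounded by blast
  have "A \<in> borel_measurable (lebesgue_on {a..b})"
    using pc_borel_measurable
    by (intro measurable_restrict_space1 measurable_completion) simp
  from measurable_bounded_by_integrable_imp_integrable[OF this integrable_const_ivl L]
  show ?thesis
    by simp
qed

lemma pc_mult_bounded: obtains L where "L > 0" "\<And>t y. t \<in> {a..b} \<Longrightarrow> norm (A t *v y) \<le> L * norm y"
proof -
  obtain L where L: "\<And>t. t \<in> {a..b} \<Longrightarrow> norm (A t) \<le> L"
    using pc_bounded by blast
  obtain C where C: "C > 0" "\<And>M y. norm ((M :: real^'n^'n) *v y) \<le> norm M * norm y * C"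
    using bounded_bilinear.pos_bounded[OF bounded_bilinear_matrix_vector] by auto
  show ?thesis
  proof (rule that[of "(\<bar>L\<bar> + 1) * C"])
    show "norm (A t *v y) \<le> (\<bar>L\<bar> + 1) * C * norm y" if "t \<in> {a..b}" for t y
    proof -
      have "norm (A t *v y) \<le> norm (A t) * (norm y * C)"
        using C(2)[of "A t" y] by (simp add: mult_ac)
      also have "\<dots> \<le> (\<bar>L\<bar> + 1) * (norm y * C)"
        using L[OF that] C(1) by (intro mult_right_mono) auto
      finally show ?thesis
        by (simp add: mult_ac)
    qed
  qed (use C in auto)
qed

lemma pc_mult_integrable:
  assumes f: "continuous_on {a..b} f"
  shows "(\<lambda>s. A s *v f s) integrable_on {a..b}"
proof -
  obtain L where L: "L > 0" "\<And>t y. t \<in> {a..b} \<Longrightarrow> norm (A t *v y) \<le> L * norm y"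
    using pc_mult_bounded by blast
  have "A \<in> borel_measurable (lebesgue_on {a..b})"
    using pc_borel_measurable
    by (intro measurable_restrict_space1 measurable_completion) simp
  moreover have "f \<in> borel_measurable (lebesgue_on {a..b})"
    by (intro continuous_imp_measurable_on_sets_lebesgue f) auto
  moreover have "continuous_on UNIV (\<lambda>x :: (real^'n^'n) \<times> (real^'n). fst x *v snd x)"
    by (intro bounded_bilinear.continuous_on[OF bounded_bilinear_matrix_vector] continuous_intros)
  ultimately have "(\<lambda>s. A s *v f s) \<in> borel_measurable (lebesgue_on {a..b})"
    by (rule borel_measurable_continuous_Pair)
  moreover have "(\<lambda>s. L * norm (f s)) integrable_on {a..b}"
    by (intro integrable_continuous_interval continuous_intros f)
  ultimately show ?thesis
    by (rule measurable_bounded_by_integrable_imp_integrable) (auto simp: L)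
qed

text \<open>The terms of the Peano-Baker series, that is, the increments of the Picard iterates
  rather than the iterates themselves.\<close>

fun picard :: "real \<Rightarrow> real^'n \<Rightarrow> nat \<Rightarrow> real \<Rightarrow> real^'n" where
  "picard t0 x 0 t = x"
| "picard t0 x (Suc k) t = integral {t0..t} (\<lambda>s. A s *v picard t0 x k s)"

lemma continuous_on_picard: "continuous_on {t0..b} (picard t0 x k)"
proof (cases k)
  case (Suc j)
  have "continuous_on {t0..b} (picard t0 x j)"
    unfolding Suc
  proof (induction j)
    case (Suc j)
    then show ?case
      by (simp add: indefinite_integral_continuous_1 pc_mult_integrable cong: continuous_on_cong)
  qed (simp cong: continuous_on_cong)
  then show ?thesis
    by (simp add: Suc indefinite_integral_continuous_1 pc_mult_integrable cong: continuous_on_cong)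
qed (simp cong: continuous_on_cong)

text \<open>The factor \<open>exp (2 * L * (t - t0))\<close> makes each Picard step halve the bound.\<close>

lemma picard_bound:
  assumes L: "L > 0" "\<And>s y. s \<in> {t0..b} \<Longrightarrow> norm (A s *v y) \<le> L * norm y"
    and t: "t \<in> {t0..b}"
  shows "norm (picard t0 x k t) \<le> norm x * exp (2 * L * (t - t0)) * (1 / 2) ^ k"
  using t
proof (induction k arbitrary: t)
  case 0
  have "norm x * 1 \<le> norm x * exp (2 * L * (t - t0))"
    using 0 L by (intro mult_left_mono) auto
  then show ?case
    by simp
next
  case (Suc k)
  \<comment> \<open>An antiderivative of the integrand below: the factor \<open>2 * L\<close> from
    differentiation absorbs one \<open>1 / 2\<close> and leaves \<open>L\<close>.\<close>
  define g where "g s = norm x * exp (2 * L * (s - t0)) * (1 / 2) ^ Suc k" for s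
  have "((\<lambda>s. L * (norm x * exp (2 * L * (s - t0)) * (1 / 2) ^ k)) has_integral (g t - g t0)) {t0..t}"
    using Suc.prems unfolding g_def
    by (intro fundamental_theorem_of_calculus)
      (auto intro!: derivative_eq_intros simp flip: has_real_derivative_iff_has_vector_derivative)
  then have "norm (picard t0 x (Suc k) t) \<le> g t - g t0"
  proof (rule order_trans[OF _ eq_refl[OF integral_unique], rotated])
    have "continuous_on {t0..t} (\<lambda>s. L * (norm x * exp (2 * L * (s - t0)) * (1 / 2) ^ k))"
      by (intro continuous_intros)
    moreover have "norm (A s *v picard t0 x k s) \<le> L * (norm x * exp (2 * L * (s - t0)) * (1 / 2) ^ k)"
      if "s \<in> {t0..t}" for s
      using L(2)[of s "picard t0 x k s"] Suc.IH[of s] that Suc.prems L(1)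
      by (auto elim!: order_trans intro!: mult_left_mono)
    ultimately show "norm (picard t0 x (Suc k) t)
        \<le> integral {t0..t} (\<lambda>s. L * (norm x * exp (2 * L * (s - t0)) * (1 / 2) ^ k))"
      unfolding picard.simps
      by (intro integral_norm_bound_integral pc_mult_integrable continuous_on_picard
          integrable_continuous_interval)
  qed
  moreover have "g t0 \<ge> 0"
    by (simp add: g_def)
  ultimately have "norm (picard t0 x (Suc k) t) \<le> g t"
    by linarith
  then show ?case
    unfolding g_def .
qed

text \<open>The Peano-Baker series converges uniformly on bounded intervals, so its sum satisfies
  the integral equation. Differentiating the integral at continuity points of \<open>A\<close> gives
  the differential equation.\<close>

lemma ex_solution: "\<exists>f. is_solution A t0 x f"
proof
  define f where "f t = (\<Sum>k. picard t0 x k t)" for t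
  \<comment> \<open>The end point \<open>b\<close> only enters the estimates; the function
    \<open>f\<close> is the same for all \<open>b\<close>, so the local statements combine to one on
    \<open>{t0..}\<close>.\<close>
  have eq: "continuous_on {t0..b} f \<and> (\<forall>t\<in>{t0..b}. f t = x + integral {t0..t} (\<lambda>s. A s *v f s))"
    for b
  proof -
    obtain L where L: "L > 0" "\<And>t y. t \<in> {t0..b} \<Longrightarrow> norm (A t *v y) \<le> L * norm y"
      using pc_mult_bounded by blast
    define M where "M k = norm x * exp (2 * L * (b - t0)) * (1 / 2) ^ k" for k :: nat
    have Mnn: "0 \<le> M k" for k
      by (simp add: M_def)
    have sM: "summable M"
      unfolding M_def by (intro summable_mult summable_geometric) auto
    have bnd: "norm (picard t0 x k t) \<le> M k" if "t \<in> {t0..b}" for k t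
    proof -
      have "norm (picard t0 x k t) \<le> norm x * exp (2 * L * (t - t0)) * (1 / 2) ^ k"
        using picard_bound[OF L that] .
      also have "\<dots> \<le> M k"
        unfolding M_def using L that by (intro mult_right_mono mult_left_mono) auto
      finally show ?thesis .
    qed
    define S where "S n t = (\<Sum>k<n. picard t0 x k t)" for n t
    have ul: "uniform_limit {t0..b} S f sequentially"
      unfolding S_def f_def by (rule Weierstrass_m_test[OF bnd sM])
    have contS: "continuous_on {t0..t} (S n)" for n t
      unfolding S_def by (intro continuous_on_sum continuous_on_picard)
    have contf: "continuous_on {t0..b} f"
      by (rule uniform_limit_theorem[OF _ ul]) (simp_all add: contS)
    have lim: "(\<lambda>n. S n t) \<longlonglongrightarrow> f t" if "t \<in> {t0..b}" for t
      using tendsto_uniform_limitI[OF ul that] .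
    have Sbnd: "norm (S n t) \<le> suminf M" if "t \<in> {t0..b}" for n t
    proof -
      have "norm (S n t) \<le> (\<Sum>k<n. M k)"
        unfolding S_def by (intro sum_norm_le bnd that)
      also have "\<dots> \<le> suminf M"
        by (intro sum_le_suminf sM) (auto simp: Mnn)
      finally show ?thesis .
    qed
    have "f t = x + integral {t0..t} (\<lambda>s. A s *v f s)" if t: "t \<in> {t0..b}" for t
    proof -
      \<comment> \<open>The partial sums are the Picard iterates, so the integral equation is the
        limit of their recursion, by dominated convergence.\<close>
      have rec: "S (Suc n) t = x + integral {t0..t} (\<lambda>s. A s *v S n s)" for n
      proof -
        have "integral {t0..t} (\<lambda>s. A s *v S n s)
            = integral {t0..t} (\<lambda>s. \<Sum>k<n. A s *v picard t0 x k s)"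
          by (simp add: S_def vec.sum)
        also have "\<dots> = (\<Sum>k<n. integral {t0..t} (\<lambda>s. A s *v picard t0 x k s))"
          by (intro integral_sum pc_mult_integrable continuous_on_picard) auto
        finally show ?thesis
          unfolding S_def by (simp add: sum.lessThan_Suc_shift del: sum.lessThan_Suc)
      qed
      have "(\<lambda>n. integral {t0..t} (\<lambda>s. A s *v S n s)) \<longlonglongrightarrow> integral {t0..t} (\<lambda>s. A s *v f s)"
      proof (rule dominated_convergence(2))
        show "(\<lambda>s. L * suminf M) integrable_on {t0..t}"
          by (rule integrable_const_ivl)
        show "norm (A s *v S n s) \<le> L * suminf M" if "s \<in> {t0..t}" for n s
          using L(2)[of s "S n s"] Sbnd[of s n] that t L(1)
          by (auto elim!: order_trans intro!: mult_left_mono)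
        show "(\<lambda>n. A s *v S n s) \<longlonglongrightarrow> A s *v f s" if "s \<in> {t0..t}" for s
          using lim[of s] that t
          by (intro bounded_linear.tendsto[OF matrix_vector_mul_bounded_linear]) auto
      qed (intro pc_mult_integrable contS)
      then have "(\<lambda>n. S (Suc n) t) \<longlonglongrightarrow> x + integral {t0..t} (\<lambda>s. A s *v f s)"
        unfolding rec by (intro tendsto_intros)
      moreover have "(\<lambda>n. S (Suc n) t) \<longlonglongrightarrow> f t"
        using lim[OF t] by (rule LIMSEQ_Suc)
      ultimately show ?thesis
        using LIMSEQ_unique by blast
    qed
    with contf show ?thesis
      by blast
  qed
  show "is_solution A t0 x f"
    unfolding is_solution_def
  proof (intro conjI allI impI)
    have cont: "continuous (at t within {t0..}) f" if "t \<in> {t0..}" for t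
    proof -
      have "at t within {t0..t + 1} = at t within {t0..}"
        by (intro at_within_nhd[of _ "{..<t + 1}"]) auto
      moreover have "continuous (at t within {t0..t + 1}) f"
        using eq[of "t + 1"] that by (auto simp: continuous_on_eq_continuous_within)
      ultimately show ?thesis
        by (simp add: continuous_within)
    qed
    then show "continuous_on {t0..} f"
      by (simp add: continuous_on_eq_continuous_within)
    show "f t0 = x"
      using eq[of t0] by auto
    fix t assume t: "t0 \<le> t" and At: "isCont A t"
    have w: "at t within {t0..t + 1} = at t within {t0..}"
      by (intro at_within_nhd[of _ "{..<t + 1}"]) auto
    have "((\<lambda>u. integral {t0..u} (\<lambda>s. A s *v f s)) has_vector_derivative A t *v f t)
        (at t within ({t0..t + 1} - {}))"
    proof (rule integral_has_vector_derivative_continuous_at)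
      show "(\<lambda>s. A s *v f s) integrable_on {t0..t + 1}"
        using eq by (intro pc_mult_integrable) auto
      have "(A \<longlongrightarrow> A t) (at t within {t0..t + 1})"
        using At by (auto simp: isCont_def intro: tendsto_within_subset)
      moreover have "(f \<longlongrightarrow> f t) (at t within {t0..t + 1})"
        using cont[of t] t unfolding w by (simp add: continuous_within)
      ultimately show "continuous (at t within ({t0..t + 1} - {})) (\<lambda>s. A s *v f s)"
        unfolding continuous_within
        by (simp add: bounded_bilinear.tendsto[OF bounded_bilinear_matrix_vector])
    qed (use t in auto)
    then have "((\<lambda>u. x + integral {t0..u} (\<lambda>s. A s *v f s)) has_vector_derivative 0 + A t *v f t)
        (at t within {t0..t + 1})"
      by (intro has_vector_derivative_add has_vector_derivative_const) simp
    then have "(f has_vector_derivative A t *v f t) (at t within {t0..t + 1})"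
      using eq[of "t + 1"] t by (auto elim!: has_vector_derivative_transform[rotated 2])
    then show "(f has_vector_derivative A t *v f t) (at t within {t0..})"
      by (simp add: has_vector_derivative_def has_derivative_def w)
  qed
qed

section \<open>A priori bounds, uniqueness and linearity of the flow\<close>

lemma is_solution_growth:
  assumes f: "is_solution A t0 x f" and N: "is_norm N" and ab: "t0 \<le> a" "a \<le> b"
    and le: "\<And>t y. t \<in> {a..<b} \<Longrightarrow>
      \<forall>\<^sub>F h in at_right 0. N (y + h *\<^sub>R (A t *v y)) \<le> (1 + c * h) * N y"
  shows "N (f b) \<le> exp (c * (b - a)) * N (f a)"
proof (rule norm_growth[OF N ab(2) _ finite_jumps[of a b]])
  show "continuous_on {a..b} f"
    using f ab by (auto simp: is_solution_def intro: continuous_on_subset)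
  fix t assume t: "t \<in> {a..<b} - jumps a b"
  then have "isCont A t"
    by (auto simp: jumps_def)
  then have "(f has_vector_derivative A t *v f t) (at t within {t0..})"
    using f t ab by (auto simp: is_solution_def)
  then show "(f has_vector_derivative A t *v f t) (at t within {a..b})"
    by (rule has_vector_derivative_within_subset) (use ab in auto)
  show "\<forall>\<^sub>F h in at_right 0. N (f t + h *\<^sub>R (A t *v f t)) \<le> (1 + c * h) * N (f t)"
    using le[of t "f t"] t by auto
qed

lemma solution_norm_bound:
  assumes L: "\<And>t y. t \<in> {a..b} \<Longrightarrow> norm (A t *v y) \<le> L * norm y"
    and f: "is_solution A t0 x f" and ab: "t0 \<le> a" "a \<le> b"
  shows "norm (f b) \<le> exp (L * (b - a)) * norm (f a)"
proof (rule is_solution_growth[OF f is_norm_norm ab])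
  fix t y assume t: "t \<in> {a..<b}"
  show "\<forall>\<^sub>F h in at_right 0. norm (y + h *\<^sub>R (A t *v y)) \<le> (1 + L * h) * norm y"
    using eventually_at_right_less[of 0]
  proof eventually_elim
    case (elim h)
    have "norm (y + h *\<^sub>R (A t *v y)) \<le> norm y + h * norm (A t *v y)"
      using norm_triangle_ineq[of y "h *\<^sub>R (A t *v y)"] elim by simp
    also have "\<dots> \<le> norm y + h * (L * norm y)"
      using L[of t y] t elim by simp
    finally show ?case
      by (simp add: algebra_simps)
  qed
qed

lemma is_solution_lincomb:
  assumes "is_solution A t0 x f" "is_solution A t0 y g"
  shows "is_solution A t0 (r *\<^sub>R x + s *\<^sub>R y) (\<lambda>t. r *\<^sub>R f t + s *\<^sub>R g t)"
  unfolding is_solution_def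
proof (intro conjI allI impI)
  show "continuous_on {t0..} (\<lambda>t. r *\<^sub>R f t + s *\<^sub>R g t)"
    using assms by (intro continuous_intros) (auto simp: is_solution_def)
  show "r *\<^sub>R f t0 + s *\<^sub>R g t0 = r *\<^sub>R x + s *\<^sub>R y"
    using assms by (simp add: is_solution_def)
  fix t assume "t0 \<le> t" "isCont A t"
  then have "((\<lambda>t. r *\<^sub>R f t + s *\<^sub>R g t) has_vector_derivative r *\<^sub>R (A t *v f t) + s *\<^sub>R (A t *v g t))
      (at t within {t0..})"
    using assms
    by (intro has_vector_derivative_add bounded_linear.has_vector_derivative[OF bounded_linear_scaleR_right])
      (auto simp: is_solution_def)
  then show "((\<lambda>t. r *\<^sub>R f t + s *\<^sub>R g t) has_vector_derivative A t *v (r *\<^sub>R f t + s *\<^sub>R g t))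
      (at t within {t0..})"
    by (simp add: matrix_vector_right_distrib matrix_vector_mult_scaleR)
qed

text \<open>The difference is a solution starting at 0, and the exponential a priori bound keeps it
  there.\<close>

lemma is_solution_unique:
  assumes f: "is_solution A t0 x f" and g: "is_solution A t0 x g" and t: "t0 \<le> t"
  shows "f t = g t"
proof -
  obtain L where L: "L > 0" "\<And>s y. s \<in> {t0..t} \<Longrightarrow> norm (A s *v y) \<le> L * norm y"
    using pc_mult_bounded by blast
  have "is_solution A t0 (1 *\<^sub>R x + (-1) *\<^sub>R x) (\<lambda>t. 1 *\<^sub>R f t + (-1) *\<^sub>R g t)"
    by (rule is_solution_lincomb[OF f g])
  from solution_norm_bound[OF L(2) this _ t] show ?thesis
    using f g by (simp add: is_solution_def)
qed

lemma is_solution_flow: "is_solution A t0 x (\<lambda>t. flow A t t0 x)"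
  unfolding flow_def using someI_ex[OF ex_solution] by simp

text \<open>\<open>flow\<close> selects a solution separately for each initial state; uniqueness is
  what makes these selections fit together linearly.\<close>

lemma flow_lincomb:
  assumes "t0 \<le> t"
  shows "flow A t t0 (r *\<^sub>R x + s *\<^sub>R y) = r *\<^sub>R flow A t t0 x + s *\<^sub>R flow A t t0 y"
  by (rule is_solution_unique[OF is_solution_flow is_solution_lincomb assms]) (rule is_solution_flow)+

lemma linear_flow: "t0 \<le> t \<Longrightarrow> linear (flow A t t0)"
  using flow_lincomb[of t0 t 1 _ 1] flow_lincomb[of t0 t _ _ 0 0]
  by (intro linearI) (simp_all add: scaleR_one)

end

subsection \<open>Liouville's formula\<close>

lemma bounded_linear_trace: "bounded_linear (trace :: real^'n^'n \<Rightarrow> real)"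
  unfolding trace_def
  by (intro bounded_linear_sum bounded_linear_compose[OF bounded_linear_vec_nth bounded_linear_vec_nth])

text \<open>Row \<open>i\<close> of \<open>M ** X\<close> is a combination of the rows of
  \<open>X\<close>. By multilinearity only the multiple \<open>M $ i $ i\<close> of row
  \<open>i\<close> survives, since every other row would occur twice.\<close>

lemma sum_det_replace_row:
  fixes M X :: "real^'n^'n"
  shows "(\<Sum>i\<in>UNIV. det (\<chi> k. if k = i then (M ** X) $ i else X $ k)) = trace M * det X"
proof -
  have "det (\<chi> k. if k = i then (M ** X) $ i else X $ k) = M $ i $ i * det X" for i
  proof -
    have "(M ** X) $ i = (\<Sum>l\<in>UNIV. M $ i $ l *s X $ l)"
      by (simp add: vec_eq_iff matrix_matrix_mult_def)
    then have "det (\<chi> k. if k = i then (M ** X) $ i else X $ k)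
        = (\<Sum>l\<in>UNIV. M $ i $ l * det (\<chi> k. if k = i then X $ l else X $ k))"
      using det_linear_row_sum[of UNIV i "\<lambda>k l. M $ i $ l *s X $ l" "\<lambda>k. X $ k"]
      by (simp add: det_row_mul cong: if_cong)
    also have "\<dots> = (\<Sum>l\<in>UNIV. if l = i then M $ i $ i * det X else 0)"
    proof (rule sum.cong[OF refl])
      fix l
      show "M $ i $ l * det (\<chi> k. if k = i then X $ l else X $ k)
          = (if l = i then M $ i $ i * det X else 0)"
      proof (cases "l = i")
        case True
        then have "(\<chi> k. if k = i then X $ l else X $ k) = X"
          by (simp add: vec_eq_iff)
        then show ?thesis
          using True by simp
      next
        case False
        then have "det (\<chi> k. if k = i then X $ l else X $ k) = 0"
          by (intro det_identical_rows[of l i]) (auto simp: row_def vec_eq_iff)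
        then show ?thesis
          using False by simp
      qed
    qed
    also have "\<dots> = M $ i $ i * det X"
      by simp
    finally show ?thesis .
  qed
  then show ?thesis
    by (simp add: trace_def sum_distrib_right)
qed

text \<open>Jacobi's formula for a curve with derivative \<open>M ** X z\<close> at
  \<open>z\<close>: the product rule in the Leibniz expansion differentiates one row at a
  time.\<close>

lemma has_field_derivative_det:
  fixes X :: "real \<Rightarrow> real^'n^'n"
  assumes X: "\<And>i j. ((\<lambda>t. X t $ i $ j) has_field_derivative (M ** X z) $ i $ j) (at z)"
  shows "((\<lambda>t. det (X t)) has_field_derivative trace M * det (X z)) (at z)"
proof -
  let ?P = "{p. p permutes (UNIV :: 'n set)}"
  let ?R = "\<lambda>i. \<chi> k. if k = i then (M ** X z) $ i else X z $ k"
  have "((\<lambda>t. det (X t)) has_field_derivative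
      (\<Sum>p\<in>?P. of_int (sign p) * (\<Sum>i\<in>UNIV. (M ** X z) $ i $ p i * (\<Prod>k\<in>UNIV - {i}. X z $ k $ p k))))
      (at z)"
    unfolding det_def by (intro DERIV_sum DERIV_cmult has_field_derivative_prod X)
  also have "(\<Sum>p\<in>?P. of_int (sign p) * (\<Sum>i\<in>UNIV. (M ** X z) $ i $ p i * (\<Prod>k\<in>UNIV - {i}. X z $ k $ p k)))
      = (\<Sum>i\<in>UNIV. det (?R i))"
  proof -
    have "(M ** X z) $ i $ p i * (\<Prod>k\<in>UNIV - {i}. X z $ k $ p k) = (\<Prod>k\<in>UNIV. ?R i $ k $ p k)"
      for i p
      by (subst prod.remove[of UNIV i]) auto
    then show ?thesis
      unfolding det_def sum_distrib_left by (simp add: sum.swap[of _ ?P])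
  qed
  finally show ?thesis
    unfolding sum_det_replace_row .
qed

text \<open>The library's volume formula for linear images needs a well-ordered index type.
  We therefore pass to coordinates indexed by the following copy of \<open>'n\<close>.\<close>

typedef 'n ordered_index = "{..CARD('n) - 1}"
  by auto

lemma card_ordered_index: "CARD('n::finite ordered_index) = CARD('n)"
  using type_definition.card[OF type_definition_ordered_index[where 'n = 'n]] by simp

instance ordered_index :: (finite) finite
proof
  show "finite (UNIV :: 'a ordered_index set)"
    using type_definition.univ[OF type_definition_ordered_index[where 'n = 'a]] by (metis finite_atMost finite_imageI)
qed

instantiation ordered_index :: (type) wellorder
begin

definition "x \<le> y \<longleftrightarrow> Rep_ordered_index x \<le> Rep_ordered_index y"

definition "x < y \<longleftrightarrow> Rep_ordered_index x < Rep_ordered_index y"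

instance
proof
  fix P :: "'a ordered_index \<Rightarrow> bool" and a
  assume step: "\<And>x. (\<And>y. y < x \<Longrightarrow> P y) \<Longrightarrow> P x"
  show "P a"
    by (induction a rule: measure_induct_rule[of Rep_ordered_index])
      (rule step, simp add: less_ordered_index_def)
qed (auto simp: less_eq_ordered_index_def less_ordered_index_def Rep_ordered_index_inject)

end

lemma ex_bij_ordered_index: "\<exists>\<beta> :: 'n::finite ordered_index \<Rightarrow> 'n. bij \<beta>"
  using finite_same_card_bij[of "UNIV :: 'n ordered_index set" "UNIV :: 'n set"]
  by (auto simp: card_ordered_index)

text \<open>The quotient \<open>q\<close> of the determinant by the claimed exponential is
  continuous and has derivative 0 off finitely many points, hence keeps its initial value 1. The
  bijection \<beta> names the coordinates by the index type needed for volumes.\<close>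

lemma det_flow:
  fixes A :: "real \<Rightarrow> real^'n^'n" and \<beta> :: "'m::finite \<Rightarrow> 'n"
  assumes A: "piecewise_continuous A" and t: "t0 \<le> t" and \<beta>: "bij \<beta>"
  shows "det (\<chi> i j. flow A t t0 (axis (\<beta> j) 1) $ \<beta> i) = exp (integral {t0..t} (\<lambda>s. trace (A s)))"
proof -
  define X :: "real \<Rightarrow> real^'m^'m" where "X s = (\<chi> i j. flow A s t0 (axis (\<beta> j) 1) $ \<beta> i)" for s
  define B :: "real \<Rightarrow> real^'m^'m" where "B s = (\<chi> i j. A s $ \<beta> i $ \<beta> j)" for s
  define I where "I s = integral {t0..s} (\<lambda>s. trace (A s))" for s
  define q where "q s = det (X s) * exp (- I s)" for s
  have comp: "X s $ i $ j = flow A s t0 (axis (\<beta> j) 1) $ \<beta> i" for s i j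
    by (simp add: X_def)
  have sol: "is_solution A t0 x (\<lambda>t. flow A t t0 x)" for x
    by (rule is_solution_flow[OF A])
  have int: "(\<lambda>s. trace (A s)) integrable_on {t0..t}"
    using integrable_linear[OF pc_integrable[OF A] bounded_linear_trace] by (simp add: o_def)
  have contX: "continuous_on {t0..t} (\<lambda>s. X s $ i $ j)" for i j
    unfolding comp
    using sol[of "axis (\<beta> j) 1"] by (intro continuous_intros) (auto simp: is_solution_def intro: continuous_on_subset)
  have "continuous_on {t0..t} (\<lambda>s. det (X s))"
    unfolding det_def by (intro continuous_intros contX)
  moreover have "continuous_on {t0..t} I"
    unfolding I_def by (rule indefinite_integral_continuous_1[OF int])
  ultimately have contq: "continuous_on {t0..t} q"
    unfolding q_def by (intro continuous_intros)
  have X0: "X t0 = mat 1"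
    using sol \<beta> by (auto simp: vec_eq_iff comp is_solution_def mat_def axis_def bij_def inj_eq)
  have trB: "trace (B s) = trace (A s)" for s
    unfolding trace_def B_def using sum.reindex_bij_betw[OF \<beta>, of "\<lambda>i. A s $ i $ i"] by simp
  have "q t = q t0"
  proof (rule has_derivative_zero_unique_strong_interval[OF _ contq refl])
    \<comment> \<open>The end points count as exceptional too, so that all remaining derivatives are
      two-sided.\<close>
    show "finite (insert t0 (insert t (jumps A t0 t)))"
      by (simp add: finite_jumps[OF A])
    fix z assume z: "z \<in> {t0..t} - insert t0 (insert t (jumps A t0 t))"
    then have cA: "isCont A z" and zi: "z \<in> interior {t0..t}"
      by (auto simp: jumps_def[OF A])
    have atz: "at z within {t0..t} = at z"
      using zi by (rule at_within_interior)
    have "((\<lambda>s. X s $ i $ j) has_field_derivative (B z ** X z) $ i $ j) (at z)" for i j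
    proof -
      have "((\<lambda>s. flow A s t0 (axis (\<beta> j) 1)) has_vector_derivative A z *v flow A z t0 (axis (\<beta> j) 1))
          (at z within {t0..})"
        using sol z cA by (auto simp: is_solution_def)
      then have "((\<lambda>s. flow A s t0 (axis (\<beta> j) 1)) has_vector_derivative A z *v flow A z t0 (axis (\<beta> j) 1))
          (at z within {t0..t})"
        by (rule has_vector_derivative_within_subset) auto
      moreover have "(A z *v flow A z t0 (axis (\<beta> j) 1)) $ \<beta> i = (B z ** X z) $ i $ j"
        using sum.reindex_bij_betw[OF \<beta>, of "\<lambda>l. A z $ \<beta> i $ l * flow A z t0 (axis (\<beta> j) 1) $ l"]
        by (simp add: comp B_def matrix_matrix_mult_def matrix_vector_mult_def)
      ultimately show ?thesis
        using bounded_linear.has_vector_derivative[OF bounded_linear_vec_nth[of "\<beta> i"]]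
        by (fastforce simp: comp atz has_real_derivative_iff_has_vector_derivative)
    qed
    then have 1: "((\<lambda>s. det (X s)) has_field_derivative trace (A z) * det (X z)) (at z)"
      unfolding trB [symmetric] by (rule has_field_derivative_det)
    have "(I has_vector_derivative trace (A z)) (at z within ({t0..t} - {}))"
      unfolding I_def
    proof (rule integral_has_vector_derivative_continuous_at[OF int])
      have "isCont (\<lambda>s. trace (A s)) z"
        using bounded_linear.isCont[OF bounded_linear_trace cA] .
      then show "continuous (at z within ({t0..t} - {})) (\<lambda>s. trace (A s))"
        by (rule continuous_at_imp_continuous_at_within)
    qed (use z in auto)
    then have 2: "(I has_field_derivative trace (A z)) (at z)"
      by (simp add: atz has_real_derivative_iff_has_vector_derivative)
    have "(q has_field_derivative 0) (at z)"
      unfolding q_def by (rule derivative_eq_intros 1 2 refl)+ (simp add: algebra_simps)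
    then show "(q has_derivative (\<lambda>h. 0)) (at z within {t0..t})"
      by (simp add: atz has_field_derivative_def lambda_zero)
  qed (use t in auto)
  then have "det (X t) * exp (- I t) = 1"
    by (simp add: q_def X0 I_def)
  then show ?thesis
    by (simp add: X_def I_def exp_minus field_simps)
qed

section \<open>Renaming coordinates, and the volume of the flow image\<close>

definition reindex :: "('m \<Rightarrow> 'n) \<Rightarrow> real^'n \<Rightarrow> real^'m" where
  "reindex \<beta> x = (\<chi> i. x $ \<beta> i)"

lemma linear_reindex: "linear (reindex \<beta>)"
  by (rule linearI) (simp_all add: reindex_def vec_eq_iff)

lemma reindex_inv:
  assumes "bij \<beta>"
  shows "reindex (inv \<beta>) (reindex \<beta> x) = x" "reindex \<beta> (reindex (inv \<beta>) y) = y"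
  using assms by (simp_all add: reindex_def vec_eq_iff bij_is_surj surj_f_inv_f bij_is_inj)

lemma norm_reindex:
  assumes "bij \<beta>"
  shows "norm (reindex \<beta> x) = norm x"
  using sum.reindex_bij_betw[OF assms, of "\<lambda>i. (x $ i)\<^sup>2"]
  by (simp add: norm_vec_def L2_set_def reindex_def)

lemma reindex_axis:
  assumes "bij \<beta>"
  shows "reindex (inv \<beta>) (axis j 1) = axis (\<beta> j) 1"
proof -
  have "inv \<beta> i = j \<longleftrightarrow> i = \<beta> j" for i
    using bij_inv_eq_iff[OF assms, of j i] by auto
  then show ?thesis
    by (simp add: reindex_def axis_def vec_eq_iff)
qed

text \<open>Renaming coordinates is an isometry, so a ball inside \<open>K\<close> goes to a ball of
  the same radius inside the image.\<close>

lemma measure_reindex_pos: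
  assumes \<beta>: "bij (\<beta> :: 'm::finite \<Rightarrow> 'n::finite)" and K: "compact K" "interior K \<noteq> {}"
  shows "0 < measure lebesgue (reindex \<beta> ` K)" "compact (reindex \<beta> ` K)"
proof -
  show cpt: "compact (reindex \<beta> ` K)"
    by (intro compact_continuous_image linear_continuous_on K)
      (simp add: linear_reindex flip: linear_conv_bounded_linear)
  obtain x e where e: "e > 0" "ball x e \<subseteq> K"
    using K(2) by (metis ex_in_conv mem_interior)
  have "ball (reindex \<beta> x) e \<subseteq> reindex \<beta> ` K"
  proof
    fix y assume y: "y \<in> ball (reindex \<beta> x) e"
    have "norm (x - reindex (inv \<beta>) y) = norm (reindex \<beta> (x - reindex (inv \<beta>) y))"
      by (simp add: norm_reindex[OF \<beta>])
    also have "\<dots> = norm (reindex \<beta> x - y)"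
      by (simp add: linear_diff[OF linear_reindex] reindex_inv[OF \<beta>])
    finally have "reindex (inv \<beta>) y \<in> K"
      using y e by (auto simp: dist_norm)
    then show "y \<in> reindex \<beta> ` K"
      using reindex_inv(2)[OF \<beta>, of y] by (metis image_eqI)
  qed
  then have le: "measure lebesgue (ball (reindex \<beta> x) e) \<le> measure lebesgue (reindex \<beta> ` K)"
    using cpt by (intro measure_mono_fmeasurable lmeasurable_compact) auto
  show "0 < measure lebesgue (reindex \<beta> ` K)"
    by (rule less_le_trans[OF _ le]) (use e(1) in simp)
qed

text \<open>Only the final time of the window is used. The inequality
  \<open>c * norm x \<le> N x\<close> puts an \<epsilon>-ball of \<open>N\<close> inside a Euclidean
  ball of radius \<open>\<epsilon> / c\<close>, whose volume does not depend on its centre.\<close>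

lemma spanning_card_lower:
  fixes A :: "real \<Rightarrow> real^'n^'n" and \<beta> :: "'m::{finite,wellorder} \<Rightarrow> 'n"
  assumes A: "piecewise_continuous A" and K: "compact K" "interior K \<noteq> {}" and T: "0 \<le> T"
    and c: "c > 0" "\<And>x. c * norm x \<le> N x"
    and E: "finite E" "spanning_set N K t0 A T \<epsilon> E"
    and \<beta>: "bij \<beta>"
  shows "measure lebesgue (reindex \<beta> ` K) * exp (integral {t0..t0 + T} (\<lambda>s. trace (A s)))
    \<le> real (card E) * measure lebesgue (ball (0::real^'m::_) (\<epsilon> / c))"
proof -
  let ?\<Phi> = "flow A (t0 + T) t0"
  \<comment> \<open>The time-\<open>T\<close> flow in the renamed coordinates, to which the volume
    formula for linear images applies.\<close>
  let ?\<Psi> = "\<lambda>y. reindex \<beta> (?\<Phi> (reindex (inv \<beta>) y))"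
  have lin0: "linear ?\<Phi>"
    using T by (intro linear_flow[OF A]) simp
  then have lin: "linear ?\<Psi>"
    using linear_compose[OF linear_compose[OF linear_reindex lin0] linear_reindex] by (simp add: o_def)
  have Kl: "reindex \<beta> ` K \<in> lmeasurable"
    using measure_reindex_pos[OF \<beta> K] by (intro lmeasurable_compact)
  have sub: "?\<Psi> ` (reindex \<beta> ` K) \<subseteq> (\<Union>x\<in>E. ball (reindex \<beta> (?\<Phi> x)) (\<epsilon> / c))"
  proof clarify
    fix y assume "y \<in> K"
    then obtain x where x: "x \<in> E" "\<forall>t\<in>{t0..t0 + T}. N (flow A t t0 y - flow A t t0 x) < \<epsilon>"
      using E(2) unfolding spanning_set_def by blast
    then have "N (?\<Phi> y - ?\<Phi> x) < \<epsilon>"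
      using T by simp
    then have "c * norm (?\<Phi> y - ?\<Phi> x) < \<epsilon>"
      using c(2)[of "?\<Phi> y - ?\<Phi> x"] by linarith
    also have "norm (?\<Phi> y - ?\<Phi> x) = norm (reindex \<beta> (?\<Phi> x) - reindex \<beta> (?\<Phi> y))"
      by (simp add: norm_reindex[OF \<beta>] norm_minus_commute flip: linear_diff[OF linear_reindex])
    finally have "?\<Psi> (reindex \<beta> y) \<in> ball (reindex \<beta> (?\<Phi> x)) (\<epsilon> / c)"
      using c(1) by (simp add: dist_norm field_simps reindex_inv[OF \<beta>])
    then show "?\<Psi> (reindex \<beta> y) \<in> (\<Union>x\<in>E. ball (reindex \<beta> (?\<Phi> x)) (\<epsilon> / c))"
      using x(1) by blast
  qed
  have "matrix ?\<Psi> = (\<chi> i j. ?\<Phi> (axis (\<beta> j) 1) $ \<beta> i)"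
    by (simp add: matrix_def reindex_axis[OF \<beta>] vec_eq_iff) (simp add: reindex_def)
  then have "det (matrix ?\<Psi>) = exp (integral {t0..t0 + T} (\<lambda>s. trace (A s)))"
    using T by (simp add: det_flow[OF A _ \<beta>])
  then have "measure lebesgue (reindex \<beta> ` K) * exp (integral {t0..t0 + T} (\<lambda>s. trace (A s)))
      = measure lebesgue (?\<Psi> ` (reindex \<beta> ` K))"
    by (simp add: measure_linear_image[OF lin Kl])
  also have "\<dots> \<le> measure lebesgue (\<Union>x\<in>E. ball (reindex \<beta> (?\<Phi> x)) (\<epsilon> / c))"
    using E(1)
    by (intro measure_mono_fmeasurable[OF sub] fmeasurableD[OF measurable_linear_image[OF lin Kl]]
        fmeasurable.finite_UN) auto
  also have "\<dots> \<le> (\<Sum>x\<in>E. measure lebesgue (ball (reindex \<beta> (?\<Phi> x)) (\<epsilon> / c)))"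
    using E(1) by (intro measure_UNION_le) auto
  also have "\<dots> = real (card E) * measure lebesgue (ball (0::real^'m::_) (\<epsilon> / c))"
  \<comment> \<open>For a negative radius the balls are empty and both sides vanish.\<close>
  proof (cases "0 \<le> \<epsilon> / c")
    case True
    then show ?thesis
      by (simp add: content_ball)
  qed (simp add: ball_empty)
  finally show ?thesis .
qed

subsection \<open>Spanning sets and entropy\<close>

text \<open>Applied to the entropy at scale \<epsilon>, which grows as \<epsilon> decreases: it
  shows that the \<open>Lim\<close> in the definition of entropy is a genuine limit.\<close>

lemma tendsto_SUP_at_right:
  fixes g :: "real \<Rightarrow> ereal"
  assumes anti: "\<And>x y. 0 < x \<Longrightarrow> x \<le> y \<Longrightarrow> g y \<le> g x"
  shows "(g \<longlongrightarrow> (SUP x\<in>{0<..}. g x)) (at_right 0)"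
proof (rule order_tendstoI)
  fix l assume "l < (SUP x\<in>{0<..}. g x)"
  then obtain x where x: "x > 0" "l < g x"
    by (auto simp: less_SUP_iff)
  have "\<forall>\<^sub>F y in at_right 0. y \<in> {0<..<x}"
    using x(1) by (rule eventually_at_right_real)
  then show "\<forall>\<^sub>F y in at_right 0. l < g y"
    by eventually_elim (use x anti in \<open>auto intro: less_le_trans\<close>)
next
  fix u assume u: "(SUP x\<in>{0<..}. g x) < u"
  have "\<forall>\<^sub>F y in at_right 0. (0::real) < y"
    by (simp add: eventually_at_right_less)
  then show "\<forall>\<^sub>F y in at_right 0. g y < u"
    by eventually_elim (use u in \<open>auto intro: le_less_trans[OF SUP_upper]\<close>)
qed

text \<open>Space is cut into cubes of side \<open>r / n\<close>, \<open>n\<close> being the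
  dimension, and one point of \<open>K\<close> is kept from each cube that meets \<open>K\<close>.
  Grid points themselves might lie outside \<open>K\<close>, where spanning sets may not go.\<close>

lemma bounded_grid_net:
  fixes K :: "(real^'n) set"
  assumes "bounded K"
  obtains C where "C > 0" "\<And>r. 0 < r \<Longrightarrow> r \<le> 1 \<Longrightarrow>
    \<exists>E\<subseteq>K. finite E \<and> real (card E) \<le> (C / r) ^ CARD('n) \<and> (\<forall>y\<in>K. \<exists>x\<in>E. norm (y - x) \<le> r)"
proof -
  let ?n = "real CARD('n)"
  have n: "?n > 0"
    by simp
  obtain M where M: "M > 0" "\<And>x. x \<in> K \<Longrightarrow> norm x \<le> M"
    using assms by (auto simp: bounded_pos)
  show ?thesis
  proof (rule that)
    \<comment> \<open>Along each axis the cubes number at most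
      \<open>2 * m + 1 \<le> 2 * (M / s) + 3\<close>; with \<open>s = r / ?n\<close> and
      \<open>r \<le> 1\<close> this is at most the constant here divided by
      \<open>r\<close>.\<close>
    show "2 * M * ?n + 3 > 0"
      using M(1) n by (simp add: add_pos_pos)
    fix r :: real assume r: "0 < r" "r \<le> 1"
    define s where "s = r / ?n"
    have s: "s > 0"
      using r n by (simp add: s_def)
    define m where "m = \<lceil>M / s\<rceil>"
    have "0 < M / s"
      using M(1) s by simp
    then have m: "m \<ge> 0" "real_of_int m \<le> M / s + 1"
      unfolding m_def by linarith+
    define cell where "cell y = (\<lambda>i. \<lfloor>y $ i / s\<rfloor>)" for y :: "real^'n"
    have "cell ` K \<subseteq> (\<Pi>\<^sub>E i\<in>UNIV. {-m..m})"
    proof (clarsimp simp: PiE_def cell_def)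
      fix y i assume "y \<in> K"
      then have "\<bar>y $ i\<bar> \<le> M"
        using component_le_norm_cart[of y i] M(2)[of y] by linarith
      then have "\<bar>y $ i / s\<bar> \<le> M / s"
        using s by (simp add: divide_right_mono)
      then show "- m \<le> \<lfloor>y $ i / s\<rfloor> \<and> \<lfloor>y $ i / s\<rfloor> \<le> m"
        unfolding m_def by linarith
    qed
    moreover have fin: "finite (\<Pi>\<^sub>E i\<in>(UNIV::'n set). {-m..m})"
      by (intro finite_PiE) auto
    ultimately have fK: "finite (cell ` K)" and
      cK: "card (cell ` K) \<le> card (\<Pi>\<^sub>E i\<in>(UNIV::'n set). {-m..m})"
      by (auto intro: finite_subset card_mono)
    define E where "E = inv_into K cell ` (cell ` K)"
    show "\<exists>E\<subseteq>K. finite E \<and> real (card E) \<le> ((2 * M * ?n + 3) / r) ^ CARD('n)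
        \<and> (\<forall>y\<in>K. \<exists>x\<in>E. norm (y - x) \<le> r)"
    proof (intro exI[of _ E] conjI ballI)
      show "E \<subseteq> K"
        by (auto simp: E_def inv_into_into)
      show "finite E"
        unfolding E_def using fK by (rule finite_imageI)
      have "card E \<le> card (cell ` K)"
        unfolding E_def using fK by (rule card_image_le)
      also have "\<dots> \<le> nat (2 * m + 1) ^ CARD('n)"
        using cK m(1) by (simp add: card_PiE)
      finally have "real (card E) \<le> real (nat (2 * m + 1) ^ CARD('n))"
        by linarith
      also have "\<dots> = (2 * real_of_int m + 1) ^ CARD('n)"
        using m(1) by simp
      also have "\<dots> \<le> ((2 * M * ?n + 3) / r) ^ CARD('n)"
      proof (rule power_mono)
        have "2 * real_of_int m + 1 \<le> 2 * (M / s) + 3"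
          using m(2) by linarith
        also have "\<dots> \<le> 2 * (M / s) + 3 / r"
          using r by (simp add: field_simps)
        also have "\<dots> = (2 * M * ?n + 3) / r"
          using r n by (simp add: s_def field_simps)
        finally show "2 * real_of_int m + 1 \<le> (2 * M * ?n + 3) / r" .
      qed (use m in auto)
      finally show "real (card E) \<le> ((2 * M * ?n + 3) / r) ^ CARD('n)" .
      fix y assume y: "y \<in> K"
      define x where "x = inv_into K cell (cell y)"
      have cx: "cell x = cell y"
        unfolding x_def using y by (intro f_inv_into_f) auto
      have "\<bar>(y - x) $ i\<bar> \<le> s" for i
      proof -
        have "\<lfloor>x $ i / s\<rfloor> = \<lfloor>y $ i / s\<rfloor>"
          using cx by (simp add: cell_def fun_eq_iff)
        then have "\<bar>y $ i / s - x $ i / s\<bar> \<le> 1"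
          by linarith
        then have "\<bar>(y $ i - x $ i) / s\<bar> \<le> 1"
          by (simp add: diff_divide_distrib)
        then show ?thesis
          using s by (simp add: abs_divide)
      qed
      \<comment> \<open>The Euclidean norm is at most the sum of the coordinates, here
        \<open>?n\<close> terms of size at most \<open>r / ?n\<close>.\<close>
      then have "(\<Sum>i\<in>UNIV. \<bar>(y - x) $ i\<bar>) \<le> (\<Sum>i\<in>(UNIV::'n set). s)"
        by (intro sum_mono)
      then have "norm (y - x) \<le> r"
        using norm_le_l1_cart[of "y - x"] by (simp add: s_def)
      then show "\<exists>x\<in>E. norm (y - x) \<le> r"
        using y by (auto simp: E_def x_def)
    qed
  qed
qed

context
  fixes A :: "real \<Rightarrow> real^'n^'n" and N :: "real^'n \<Rightarrow> real" and K :: "(real^'n) set" and t0 :: real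
  assumes A: "piecewise_continuous A" and N: "is_norm N"
    and K: "compact K" "interior K \<noteq> {}"
begin

abbreviation (input) "S \<equiv> min_spanning_card N K t0 A"

definition entropy_at_scale :: "real \<Rightarrow> ereal" where
  "entropy_at_scale \<epsilon> = Limsup at_top (\<lambda>T. ereal (1 / T * ln (real (S \<epsilon> T))))"

lemma flow_bounded:
  obtains L where "L > 0" "\<And>t x. t \<in> {t0..b} \<Longrightarrow> norm (flow A t t0 x) \<le> exp (L * (t - t0)) * norm x"
proof -
  obtain L where L: "L > 0" "\<And>t y. t \<in> {t0..b} \<Longrightarrow> norm (A t *v y) \<le> L * norm y"
    using pc_mult_bounded[OF A] by blast
  have sol: "is_solution A t0 x (\<lambda>t. flow A t t0 x)" for x
    by (rule is_solution_flow[OF A])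
  have "norm (flow A t t0 x) \<le> exp (L * (t - t0)) * norm x" if "t \<in> {t0..b}" for t x
    using solution_norm_bound[OF A _ sol[of x], of t0 t L] sol[of x] L(2) that
    by (auto simp: is_solution_def)
  with L(1) show ?thesis
    by (rule that)
qed

text \<open>By linearity the gap between two trajectories is the trajectory of the gap, so a bound
  \<open>D\<close> valid on the whole window acts as a Lipschitz constant.\<close>

lemma spanning_set_net:
  assumes D: "D > 0" "\<And>t x. t \<in> {t0..t0 + T} \<Longrightarrow> N (flow A t t0 x) \<le> D * norm x"
    and E: "E \<subseteq> K" "\<And>y. y \<in> K \<Longrightarrow> \<exists>x\<in>E. norm (y - x) \<le> r" and r: "D * r < \<epsilon>"
  shows "spanning_set N K t0 A T \<epsilon> E"
  unfolding spanning_set_def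
proof (intro conjI ballI E(1))
  fix y assume "y \<in> K"
  then obtain x where x: "x \<in> E" "norm (y - x) \<le> r"
    using E(2) by blast
  have "N (flow A t t0 y - flow A t t0 x) < \<epsilon>" if t: "t \<in> {t0..t0 + T}" for t
  proof -
    have "flow A t t0 y - flow A t t0 x = flow A t t0 (y - x)"
      using t by (intro linear_diff[symmetric] linear_flow[OF A]) auto
    then have "N (flow A t t0 y - flow A t t0 x) \<le> D * norm (y - x)"
      using D(2)[OF t] by simp
    also have "\<dots> \<le> D * r"
      using x(2) D(1) by simp
    finally show ?thesis
      using r by simp
  qed
  with x(1) show "\<exists>x\<in>E. \<forall>t\<in>{t0..t0 + T}. N (flow A t t0 y - flow A t t0 x) < \<epsilon>"
    by blast
qed

text \<open>Without a finite spanning set the \<open>LEAST\<close> in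
  \<open>min_spanning_card\<close> would be unspecified. The crude growth bound on a bounded window
  is enough for this.\<close>

lemma ex_finite_spanning_set:
  assumes \<epsilon>: "\<epsilon> > 0"
  shows "\<exists>E. finite E \<and> spanning_set N K t0 A T \<epsilon> E"
proof -
  obtain L where L: "L > 0"
    "\<And>t x. t \<in> {t0..t0 + T} \<Longrightarrow> norm (flow A t t0 x) \<le> exp (L * (t - t0)) * norm x"
    using flow_bounded by blast
  obtain C where C: "C > 0" "\<And>x. N x \<le> C * norm x"
    using is_norm_upper[OF N] by blast
  obtain B where B: "B > 0" "\<And>r. 0 < r \<Longrightarrow> r \<le> 1 \<Longrightarrow>
    \<exists>E\<subseteq>K. finite E \<and> real (card E) \<le> (B / r) ^ CARD('n) \<and> (\<forall>y\<in>K. \<exists>x\<in>E. norm (y - x) \<le> r)"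
    using bounded_grid_net[OF compact_imp_bounded[OF K(1)]] by blast
  define D where "D = C * exp (L * T)"
  have D: "D > 0"
    using C by (simp add: D_def)
  define r where "r = min 1 (\<epsilon> / (2 * D))"
  have r: "0 < r" "r \<le> 1"
    using D \<epsilon> by (auto simp: r_def)
  have "D * r \<le> D * (\<epsilon> / (2 * D))"
    using D by (intro mult_left_mono) (auto simp: r_def)
  then have small: "D * r < \<epsilon>"
    using D \<epsilon> by simp
  have bnd: "N (flow A t t0 x) \<le> D * norm x" if "t \<in> {t0..t0 + T}" for t x
  proof -
    have "exp (L * (t - t0)) \<le> exp (L * T)"
      using that L(1) by simp
    then have "norm (flow A t t0 x) \<le> exp (L * T) * norm x"
      using L(2)[OF that, of x] by (meson mult_right_mono norm_ge_zero order_trans)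
    then have "C * norm (flow A t t0 x) \<le> C * (exp (L * T) * norm x)"
      using C(1) by simp
    then show ?thesis
      using C(2)[of "flow A t t0 x"] by (simp add: D_def mult.assoc)
  qed
  obtain E where E: "E \<subseteq> K" "finite E" "\<And>y. y \<in> K \<Longrightarrow> \<exists>x\<in>E. norm (y - x) \<le> r"
    using B(2)[OF r] by blast
  show ?thesis
    using spanning_set_net[OF D bnd E(1,3) small] E(2) by blast
qed

section \<open>Minimal spanning cardinalities and the entropy as a supremum over scales\<close>

lemma min_spanning_card_le:
  assumes "finite E" "spanning_set N K t0 A T \<epsilon> E"
  shows "S \<epsilon> T \<le> card E"
  unfolding min_spanning_card_def by (rule Least_le) (use assms in blast)

lemma min_spanning_card_attained:
  assumes "\<epsilon> > 0"
  obtains E where "finite E" "card E = S \<epsilon> T" "spanning_set N K t0 A T \<epsilon> E"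
proof -
  let ?P = "\<lambda>k. \<exists>E. finite E \<and> card E = k \<and> spanning_set N K t0 A T \<epsilon> E"
  have "\<exists>k. ?P k"
    using ex_finite_spanning_set[OF assms] by blast
  then have "?P (S \<epsilon> T)"
    unfolding min_spanning_card_def by (rule LeastI_ex)
  then show ?thesis
    using that by blast
qed

lemma min_spanning_card_pos:
  assumes "\<epsilon> > 0"
  shows "S \<epsilon> T \<ge> 1"
proof -
  obtain E where E: "finite E" "card E = S \<epsilon> T" "spanning_set N K t0 A T \<epsilon> E"
    using min_spanning_card_attained[OF assms] by blast
  have "K \<noteq> {}"
    using K(2) interior_subset[of K] by blast
  then have "E \<noteq> {}"
    using E(3) by (auto simp: spanning_set_def)
  then have "card E > 0"
    using E(1) by (simp add: card_gt_0_iff)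
  then show ?thesis
    using E(2) by simp
qed

lemma min_spanning_card_antimono:
  assumes "0 < \<epsilon>" "\<epsilon> \<le> \<delta>"
  shows "S \<delta> T \<le> S \<epsilon> T"
proof -
  obtain E where E: "finite E" "card E = S \<epsilon> T" "spanning_set N K t0 A T \<epsilon> E"
    using min_spanning_card_attained[OF assms(1)] by blast
  have "spanning_set N K t0 A T \<delta> E"
    using E(3) assms(2) unfolding spanning_set_def by (meson less_le_trans)
  with E(1) show ?thesis
    using min_spanning_card_le E(2) by metis
qed

text \<open>Hence an upper bound must be shown at every scale, whereas a lower bound at the single
  scale 1 suffices.\<close>

lemma topological_entropy_eq_SUP:
  "topological_entropy N K t0 A = (SUP \<epsilon>\<in>{0<..}. entropy_at_scale \<epsilon>)"
proof -
  have "entropy_at_scale \<delta> \<le> entropy_at_scale \<epsilon>" if "0 < \<epsilon>" "\<epsilon> \<le> \<delta>" for \<epsilon> \<delta>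
    unfolding entropy_at_scale_def
  proof (rule Limsup_mono)
    show "\<forall>\<^sub>F T in at_top. ereal (1 / T * ln (real (S \<delta> T))) \<le> ereal (1 / T * ln (real (S \<epsilon> T)))"
      using eventually_gt_at_top[of 0]
    proof eventually_elim
      case (elim T)
      have "ln (real (S \<delta> T)) \<le> ln (real (S \<epsilon> T))"
        using min_spanning_card_antimono[OF that, of T] min_spanning_card_pos[of \<delta> T] that by simp
      then show ?case
        using elim by (simp add: divide_right_mono)
    qed
  qed
  then have "(entropy_at_scale \<longlongrightarrow> (SUP \<epsilon>\<in>{0<..}. entropy_at_scale \<epsilon>)) (at_right 0)"
    by (rule tendsto_SUP_at_right)
  then have "Lim (at_right 0) entropy_at_scale = (SUP \<epsilon>\<in>{0<..}. entropy_at_scale \<epsilon>)"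
    by (intro tendsto_Lim) auto
  then show ?thesis
    by (simp add: topological_entropy_def entropy_at_scale_def [abs_def])
qed

text \<open>A net of mesh \<open>r\<close> has at most \<open>(B / r) ^ CARD('n)\<close> points.
  With \<open>r\<close> proportional to \<open>exp (- c * T)\<close> the logarithm grows like
  \<open>CARD('n) * c * T\<close>, and all other terms are constant in \<open>T\<close>.\<close>

lemma topological_entropy_upper:
  assumes c: "c \<ge> 0" and D: "D > 0"
    and growth: "\<And>t x. t0 \<le> t \<Longrightarrow> N (flow A t t0 x) \<le> D * exp (c * (t - t0)) * norm x"
  shows "topological_entropy N K t0 A \<le> ereal (real CARD('n) * c)"
  unfolding topological_entropy_eq_SUP
proof (rule SUP_least)
  fix \<epsilon> :: real assume "\<epsilon> \<in> {0<..}"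
  then have \<epsilon>: "\<epsilon> > 0"
    by simp
  let ?n = "real CARD('n)"
  obtain B where B: "B > 0" "\<And>r. 0 < r \<Longrightarrow> r \<le> 1 \<Longrightarrow>
    \<exists>E\<subseteq>K. finite E \<and> real (card E) \<le> (B / r) ^ CARD('n) \<and> (\<forall>y\<in>K. \<exists>x\<in>E. norm (y - x) \<le> r)"
    using bounded_grid_net[OF compact_imp_bounded[OF K(1)]] by blast
  \<comment> \<open>Chosen to satisfy both \<open>D / F < \<epsilon>\<close>, which makes the net
    spanning, and \<open>F \<ge> 1\<close>, which together with \<open>c \<ge> 0\<close> keeps the
    mesh at most 1.\<close>
  define F where "F = 1 + 2 * D / \<epsilon>"
  have F: "F \<ge> 1" "F > 0"
    using D \<epsilon> by (auto simp: F_def add_pos_pos)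
  have bound: "ln (real (S \<epsilon> T)) \<le> ?n * (ln (B * F) + c * T)" if T: "T > 0" for T
  proof -
    define r where "r = 1 / (F * exp (c * T))"
    have "1 * 1 \<le> F * exp (c * T)"
      using F c T by (intro mult_mono) auto
    then have r: "0 < r" "r \<le> 1"
      using F by (auto simp: r_def)
    have DT: "D * exp (c * T) > 0"
      using D by simp
    obtain E where E: "E \<subseteq> K" "finite E" "real (card E) \<le> (B / r) ^ CARD('n)"
      "\<And>y. y \<in> K \<Longrightarrow> \<exists>x\<in>E. norm (y - x) \<le> r"
      using B(2)[OF r] by blast
    have "D * exp (c * T) * r = D / F"
      by (simp add: r_def)
    also have "\<dots> < \<epsilon>"
    proof -
      have "\<epsilon> * F = \<epsilon> + 2 * D"
        using \<epsilon> by (simp add: F_def field_simps)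
      then show ?thesis
        using D \<epsilon> F by (simp add: pos_divide_less_eq)
    qed
    finally have small: "D * exp (c * T) * r < \<epsilon>" .
    have "N (flow A t t0 x) \<le> D * exp (c * T) * norm x" if t: "t \<in> {t0..t0 + T}" for t x
    proof -
      have "N (flow A t t0 x) \<le> D * exp (c * (t - t0)) * norm x"
        using growth t by auto
      also have "\<dots> \<le> D * exp (c * T) * norm x"
        using D c t by (intro mult_right_mono mult_left_mono) (auto intro: mult_left_mono)
      finally show ?thesis .
    qed
    then have "spanning_set N K t0 A T \<epsilon> E"
      by (rule spanning_set_net[OF DT _ E(1,4) small])
    then have "real (S \<epsilon> T) \<le> real (card E)"
      using min_spanning_card_le[OF E(2)] by simp
    also have "\<dots> \<le> (B / r) ^ CARD('n)"
      by (rule E(3))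
    also have "B / r = B * F * exp (c * T)"
      by (simp add: r_def)
    finally have "ln (real (S \<epsilon> T)) \<le> ln ((B * F * exp (c * T)) ^ CARD('n))"
      using min_spanning_card_pos[OF \<epsilon>, of T] B(1) F by (subst ln_le_cancel_iff) auto
    also have "\<dots> = ?n * (ln (B * F) + c * T)"
      using B(1) F by (simp add: ln_realpow ln_mult)
    finally show ?thesis .
  qed
  have "entropy_at_scale \<epsilon> \<le> Limsup at_top (\<lambda>T. ereal (?n * ln (B * F) / T + ?n * c))"
    unfolding entropy_at_scale_def
  proof (rule Limsup_mono)
    show "\<forall>\<^sub>F T in at_top. ereal (1 / T * ln (real (S \<epsilon> T))) \<le> ereal (?n * ln (B * F) / T + ?n * c)"
      using eventually_gt_at_top[of 0]
    proof eventually_elim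
      case (elim T)
      have "1 / T * ln (real (S \<epsilon> T)) \<le> 1 / T * (?n * (ln (B * F) + c * T))"
        using bound[OF elim] elim by (intro mult_left_mono) auto
      also have "\<dots> = ?n * ln (B * F) / T + ?n * c"
        using elim by (simp add: field_simps)
      finally show ?case
        by simp
    qed
  qed
  also have "((\<lambda>T. ?n * ln (B * F) / T + ?n * c) \<longlongrightarrow> 0 + ?n * c) at_top"
    by (intro tendsto_intros tendsto_divide_0[OF tendsto_const] filterlim_at_top_imp_at_infinity filterlim_ident)
  then have "Limsup at_top (\<lambda>T. ereal (?n * ln (B * F) / T + ?n * c)) = ereal (0 + ?n * c)"
    by (intro lim_imp_Limsup) (simp_all add: trivial_limit_at_top_linorder)
  finally show "entropy_at_scale \<epsilon> \<le> ereal (?n * c)"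
    by simp
qed

text \<open>The infinitesimal bound in \<open>N'\<close> takes over from some time \<open>T0\<close>
  on; before that a crude exponential bound serves. The transient and the changes of norm affect
  only the prefactor of \<open>exp (c * (t - t0))\<close>.\<close>

lemma topological_entropy_le_log_norm:
  assumes N': "is_norm N'" and c: "c \<ge> 0"
    and le: "\<forall>\<^sub>F t in at_top. \<forall>y. \<forall>\<^sub>F h in at_right 0. N' (y + h *\<^sub>R (A t *v y)) \<le> (1 + c * h) * N' y"
  shows "topological_entropy N K t0 A \<le> ereal (real CARD('n) * c)"
proof -
  obtain T where T: "\<And>t y. T \<le> t \<Longrightarrow>
      \<forall>\<^sub>F h in at_right 0. N' (y + h *\<^sub>R (A t *v y)) \<le> (1 + c * h) * N' y"
    using le by (auto simp: eventually_at_top_linorder)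
  define T0 where "T0 = max T t0"
  obtain L where L: "L > 0" "\<And>t x. t \<in> {t0..T0} \<Longrightarrow> norm (flow A t t0 x) \<le> exp (L * (t - t0)) * norm x"
    using flow_bounded by blast
  define D where "D = exp (L * (T0 - t0))"
  have D: "D > 0" "norm (flow A t t0 x) \<le> D * norm x" if "t \<in> {t0..T0}" for t x
  proof -
    have "exp (L * (t - t0)) * norm x \<le> D * norm x"
      unfolding D_def using that L(1) by (intro mult_right_mono) auto
    then show "norm (flow A t t0 x) \<le> D * norm x"
      using L(2)[OF that, of x] by linarith
  qed (simp add: D_def)
  have D0: "D > 0"
    by (simp add: D_def)
  obtain C1 where C1: "C1 > 0" "\<And>x. C1 * norm x \<le> N' x"
    using is_norm_lower[OF N'] by blast
  obtain C2 where C2: "C2 > 0" "\<And>x. N' x \<le> C2 * norm x"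
    using is_norm_upper[OF N'] by blast
  obtain C3 where C3: "C3 > 0" "\<And>x. N x \<le> C3 * norm x"
    using is_norm_upper[OF N] by blast
  \<comment> \<open>The summand 1 covers times up to \<open>T0\<close>; the summand
    \<open>C2 / C1\<close> covers later times and is the price of passing to \<open>N'\<close> and
    back.\<close>
  define G where "G = (1 + C2 / C1) * D"
  have G: "G > 0"
    using C1 C2 D0 by (simp add: G_def add_pos_pos)
  have main: "norm (flow A t t0 x) \<le> G * exp (c * (t - t0)) * norm x" if t: "t0 \<le> t" for t x
  proof (cases "t \<le> T0")
    case True
    have "D * 1 \<le> G * exp (c * (t - t0))"
      using C1 C2 D0 c t unfolding G_def by (intro mult_mono) auto
    then have "D * norm x \<le> G * exp (c * (t - t0)) * norm x"
      by (intro mult_right_mono) auto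
    then show ?thesis
      using D(2)[of t x] True t by simp
  next
    case False
    have "N' (flow A t t0 x) \<le> exp (c * (t - T0)) * N' (flow A T0 t0 x)"
      using False
      by (intro is_solution_growth[OF A is_solution_flow[OF A] N' _ _ T]) (auto simp: T0_def)
    also have "\<dots> \<le> exp (c * (t - t0)) * (C2 * (D * norm x))"
    proof (intro mult_mono)
      show "exp (c * (t - T0)) \<le> exp (c * (t - t0))"
        using c by (auto simp: T0_def intro: mult_left_mono)
      have "C2 * norm (flow A T0 t0 x) \<le> C2 * (D * norm x)"
        using D(2)[of T0 x] C2(1) by (simp add: T0_def)
      then show "N' (flow A T0 t0 x) \<le> C2 * (D * norm x)"
        using C2(2)[of "flow A T0 t0 x"] by linarith
    qed (auto simp: is_norm_nonneg[OF N'])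
    finally have "C1 * norm (flow A t t0 x) \<le> exp (c * (t - t0)) * (C2 * (D * norm x))"
      using C1(2)[of "flow A t t0 x"] by linarith
    then have "norm (flow A t t0 x) \<le> C2 / C1 * D * exp (c * (t - t0)) * norm x"
      using C1(1) by (simp add: field_simps)
    also have "\<dots> \<le> G * exp (c * (t - t0)) * norm x"
      using D0 by (intro mult_right_mono) (simp_all add: G_def distrib_right)
    finally show ?thesis .
  qed
  show ?thesis
  proof (rule topological_entropy_upper[OF c, of "C3 * G"])
    show "C3 * G > 0"
      using C3 G by simp
    fix t x assume "t0 \<le> t"
    then have "C3 * norm (flow A t t0 x) \<le> C3 * (G * exp (c * (t - t0)) * norm x)"
      using C3(1) by (intro mult_left_mono main) auto
    then show "N (flow A t t0 x) \<le> C3 * G * exp (c * (t - t0)) * norm x"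
      using C3(2)[of "flow A t t0 x"] by (simp add: mult.assoc)
  qed
qed

lemma topological_entropy_nonneg: "0 \<le> topological_entropy N K t0 A"
proof -
  have "(0::ereal) = Limsup (at_top :: real filter) (\<lambda>T. 0)"
    by (simp add: Limsup_const trivial_limit_at_top_linorder)
  also have "\<dots> \<le> entropy_at_scale 1"
    unfolding entropy_at_scale_def
  proof (rule Limsup_mono)
    show "\<forall>\<^sub>F T in at_top. 0 \<le> ereal (1 / T * ln (real (S 1 T)))"
      using eventually_gt_at_top[of 0]
      by eventually_elim (use min_spanning_card_pos[of 1] in simp)
  qed
  also have "\<dots> \<le> topological_entropy N K t0 A"
    unfolding topological_entropy_eq_SUP by (rule SUP_upper) simp
  finally show ?thesis .
qed

text \<open>The volume comparison at scale 1 gives \<open>ln (V / W) + J + c * T\<close> as a lower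
  bound for the logarithm, with \<open>V\<close>, \<open>W\<close> and \<open>J\<close> independent
  of \<open>T\<close>.\<close>

lemma topological_entropy_ge_trace:
  assumes c: "\<forall>\<^sub>F t in at_top. c \<le> trace (A t)"
  shows "ereal c \<le> topological_entropy N K t0 A"
proof -
  obtain \<beta> :: "'n ordered_index \<Rightarrow> 'n" where \<beta>: "bij \<beta>"
    using ex_bij_ordered_index by blast
  obtain k where k: "k > 0" "\<And>x. k * norm x \<le> N x"
    using is_norm_lower[OF N] by blast
  obtain T1 where T1: "\<And>t. T1 \<le> t \<Longrightarrow> c \<le> trace (A t)"
    using c by (auto simp: eventually_at_top_linorder)
  define T0 where "T0 = max T1 t0"
  let ?tr = "\<lambda>s. trace (A s)"
  have int: "?tr integrable_on {a..b}" for a b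
    using integrable_linear[OF pc_integrable[OF A] bounded_linear_trace] by (simp add: o_def)
  \<comment> \<open>Corrects for the initial window \<open>{t0..T0}\<close>, on which the trace need
    not reach \<open>c\<close>.\<close>
  define J where "J = integral {t0..T0} ?tr - c * (T0 - t0)"
  have trint: "J + c * T \<le> integral {t0..t0 + T} ?tr" if "T0 \<le> t0 + T" for T
  proof -
    have "integral {t0..t0 + T} ?tr = integral {t0..T0} ?tr + integral {T0..t0 + T} ?tr"
      using that by (intro Henstock_Kurzweil_Integration.integral_combine[symmetric] int) (auto simp: T0_def)
    moreover have "integral {T0..t0 + T} (\<lambda>_. c) \<le> integral {T0..t0 + T} ?tr"
      using T1 by (intro integral_le int integrable_const_ivl) (auto simp: T0_def)
    ultimately show ?thesis
      using that by (simp add: J_def algebra_simps)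
  qed
  define V where "V = measure lebesgue (reindex \<beta> ` K)"
  define W where "W = measure lebesgue (ball (0::real^('n ordered_index)) (1 / k))"
  have V: "V > 0"
    unfolding V_def by (rule measure_reindex_pos[OF \<beta> K])
  have W: "W > 0"
    unfolding W_def using k(1) by simp
  have bound: "ln (V / W) + J + c * T \<le> ln (real (S 1 T))" if T: "T \<ge> 0" "T0 \<le> t0 + T" for T
  proof -
    obtain E where E: "finite E" "card E = S 1 T" "spanning_set N K t0 A T 1 E"
      using min_spanning_card_attained[of 1] by auto
    have "V * exp (J + c * T) \<le> V * exp (integral {t0..t0 + T} ?tr)"
      using trint[OF T(2)] V by simp
    also have "\<dots> \<le> real (S 1 T) * W"
      using spanning_card_lower[OF A K T(1) k E(1,3) \<beta>] by (simp add: V_def W_def E(2))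
    finally have "V / W * exp (J + c * T) \<le> real (S 1 T)"
      using W by (simp add: field_simps)
    then have "ln (V / W * exp (J + c * T)) \<le> ln (real (S 1 T))"
      using V W min_spanning_card_pos[of 1 T] by (subst ln_le_cancel_iff) auto
    moreover have "ln (V / W * exp (J + c * T)) = ln (V / W) + (J + c * T)"
      using V W by (subst ln_mult) auto
    ultimately show ?thesis
      by simp
  qed
  have "((\<lambda>T. (ln (V / W) + J) / T + c) \<longlongrightarrow> 0 + c) at_top"
    by (intro tendsto_intros tendsto_divide_0[OF tendsto_const] filterlim_at_top_imp_at_infinity filterlim_ident)
  then have "ereal (0 + c) = Limsup at_top (\<lambda>T. ereal ((ln (V / W) + J) / T + c))"
    by (intro lim_imp_Limsup[symmetric]) (simp_all add: trivial_limit_at_top_linorder)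
  also have "\<dots> \<le> entropy_at_scale 1"
    unfolding entropy_at_scale_def
  proof (rule Limsup_mono)
    show "\<forall>\<^sub>F T in at_top. ereal ((ln (V / W) + J) / T + c) \<le> ereal (1 / T * ln (real (S 1 T)))"
      using eventually_gt_at_top[of 0] eventually_ge_at_top[of "T0 - t0"]
    proof eventually_elim
      case (elim T)
      have "(ln (V / W) + J) / T + c = 1 / T * (ln (V / W) + J + c * T)"
        using elim by (simp add: field_simps)
      also have "\<dots> \<le> 1 / T * ln (real (S 1 T))"
        using bound[of T] elim by (intro mult_left_mono) auto
      finally show ?case
        by simp
    qed
  qed
  also have "\<dots> \<le> topological_entropy N K t0 A"
    unfolding topological_entropy_eq_SUP by (rule SUP_upper) simp
  finally show ?thesis
    by simp
qed

end

subsection \<open>Matrix measures\<close>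

text \<open>Applied to the difference quotients of the matrix measure, so that its
  \<open>Lim\<close> is a genuine limit.\<close>

lemma tendsto_INF_at_right:
  fixes g :: "real \<Rightarrow> real"
  assumes mono: "\<And>x y. 0 < x \<Longrightarrow> x \<le> y \<Longrightarrow> g x \<le> g y" and bdd: "\<And>x. 0 < x \<Longrightarrow> b \<le> g x"
  shows "(g \<longlongrightarrow> (INF x\<in>{0<..}. g x)) (at_right 0)"
proof (rule order_tendstoI)
  have bb: "bdd_below (g ` {0<..})"
    using bdd by (intro bdd_belowI[of _ b]) auto
  have pos: "\<forall>\<^sub>F y in at_right 0. (0::real) < y"
    by (simp add: eventually_at_right_less)
  fix a
  {
    assume "a < (INF x\<in>{0<..}. g x)"
    then show "\<forall>\<^sub>F y in at_right 0. a < g y"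
      using pos by (auto elim!: eventually_mono intro: less_le_trans[OF _ cINF_lower[OF bb]])
  next
    assume "(INF x\<in>{0<..}. g x) < a"
    then obtain x where x: "x > 0" "g x < a"
      using cINF_less_iff[OF _ bb] by auto
    have "\<forall>\<^sub>F y in at_right 0. y \<in> {0<..<x}"
      using x(1) by (rule eventually_at_right_real)
    then show "\<forall>\<^sub>F y in at_right 0. g y < a"
    proof eventually_elim
      case (elim y)
      then show ?case
        using mono[of y x] x(2) by simp
    qed
  }
qed

context
  fixes N :: "real^'n \<Rightarrow> real"
  assumes N: "is_norm N"
begin

text \<open>A real \<open>SUP\<close> means something only over a bounded set; the bound comes from
  equivalence with the Euclidean norm.\<close>

lemma induced_norm_bdd_above: "bdd_above ((\<lambda>x. N (M *v x) / N x) ` {x. x \<noteq> 0})"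
proof -
  obtain C where C: "C > 0" "\<And>x. N x \<le> C * norm x"
    using is_norm_upper[OF N] by blast
  obtain c where c: "c > 0" "\<And>x. c * norm x \<le> N x"
    using is_norm_lower[OF N] by blast
  obtain L where L: "\<And>x. norm (M *v x) \<le> L * norm x" "L > 0"
    using bounded_linear.pos_bounded[OF matrix_vector_mul_bounded_linear[of M]]
    by (metis mult.commute)
  have "N (M *v x) / N x \<le> C * L / c" if "x \<noteq> 0" for x
  proof -
    have "N (M *v x) \<le> C * norm (M *v x)"
      by (rule C)
    also have "\<dots> \<le> C * (L * norm x)"
      using C(1) L(1)[of x] by simp
    also have "\<dots> \<le> C * (L * (N x / c))"
      using C(1) L(2) c(1) c(2)[of x] by (intro mult_left_mono) (auto simp: field_simps)
    finally show ?thesis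
      using is_norm_pos[OF N that] by (simp add: field_simps)
  qed
  then show ?thesis
    by (intro bdd_aboveI[of _ "C * L / c"]) auto
qed

lemma induced_norm_bound: "N (M *v x) \<le> induced_norm N M * N x"
proof (cases "x = 0")
  case True
  then show ?thesis
    using is_norm_eq_0[OF N, of 0] by simp
next
  case False
  then have "N (M *v x) / N x \<le> induced_norm N M"
    unfolding induced_norm_def by (intro cSUP_upper induced_norm_bdd_above) simp
  then show ?thesis
    using is_norm_pos[OF N False] by (simp add: field_simps)
qed

lemma induced_norm_least:
  assumes "\<And>x. N (M *v x) \<le> C * N x"
  shows "induced_norm N M \<le> C"
  unfolding induced_norm_def
proof (rule cSUP_least)
  have "axis undefined 1 \<noteq> (0::real^'n)"
    by (simp add: axis_eq_0_iff)
  then show "{x::real^'n. x \<noteq> 0} \<noteq> {}"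
    by blast
  fix x :: "real^'n" assume "x \<in> {x. x \<noteq> 0}"
  then show "N (M *v x) / N x \<le> C"
    using assms[of x] is_norm_pos[OF N, of x] by (simp add: field_simps)
qed

lemma induced_norm_mat_1: "1 \<le> induced_norm N (mat 1 :: real^'n^'n)"
proof -
  have "axis undefined 1 \<noteq> (0::real^'n)"
    by (simp add: axis_eq_0_iff)
  then have "0 < N (axis undefined 1)"
    by (rule is_norm_pos[OF N])
  with induced_norm_bound[of "mat 1" "axis undefined 1"] show ?thesis
    by simp
qed

lemma induced_norm_add: "induced_norm N (M + M') \<le> induced_norm N M + induced_norm N M'"
proof (rule induced_norm_least)
  fix x
  have "N ((M + M') *v x) \<le> N (M *v x) + N (M' *v x)"
    unfolding matrix_vector_mult_add_rdistrib by (rule is_norm_triangle[OF N])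
  then show "N ((M + M') *v x) \<le> (induced_norm N M + induced_norm N M') * N x"
    using induced_norm_bound[of M x] induced_norm_bound[of M' x] by (simp add: distrib_right)
qed

lemma induced_norm_scaleR:
  assumes "0 \<le> c"
  shows "induced_norm N (c *\<^sub>R M) \<le> c * induced_norm N M"
proof (rule induced_norm_least)
  fix x
  have "N ((c *\<^sub>R M) *v x) = c * N (M *v x)"
    using assms by (simp add: is_norm_scaleR[OF N] flip: scaleR_matrix_vector_assoc)
  then show "N ((c *\<^sub>R M) *v x) \<le> c * induced_norm N M * N x"
    using mult_left_mono[OF induced_norm_bound[of M x] assms] by (simp add: mult.assoc)
qed

text \<open>The quotient \<open>q\<close> is monotone, by convexity of the induced norm, and bounded
  below, so it does converge to the matrix measure. Then \<open>q h < c\<close> for small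
  \<open>h\<close>, which says that \<open>mat 1 + h *\<^sub>R M\<close> has induced norm below
  \<open>1 + c * h\<close>.\<close>

lemma matrix_measure_log_norm:
  assumes "matrix_measure (induced_norm N) M < c"
  shows "\<forall>\<^sub>F h in at_right 0. N (y + h *\<^sub>R (M *v y)) \<le> (1 + c * h) * N y"
proof -
  let ?\<nu> = "induced_norm N"
  define q where "q t = (?\<nu> (mat 1 + t *\<^sub>R M) - 1) / t" for t
  have mono: "q s \<le> q t" if "0 < s" "s \<le> t" for s t
  proof -
    \<comment> \<open>For \<open>s \<le> t\<close> the matrix at \<open>s\<close> is the convex
      combination, with weight \<open>s / t\<close>, of the identity and the matrix at
      \<open>t\<close>.\<close>
    define r where "r = s / t"
    have r: "0 \<le> r" "r \<le> 1" "s = r * t"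
      using that by (auto simp: r_def)
    have "mat 1 + s *\<^sub>R M = (1 - r) *\<^sub>R mat 1 + r *\<^sub>R (mat 1 + t *\<^sub>R M)"
      using r by (simp add: algebra_simps)
    then have "?\<nu> (mat 1 + s *\<^sub>R M) \<le> (1 - r) * ?\<nu> (mat 1 :: real^'n^'n) + r * ?\<nu> (mat 1 + t *\<^sub>R M)"
      using induced_norm_add[of "(1 - r) *\<^sub>R mat 1" "r *\<^sub>R (mat 1 + t *\<^sub>R M)"]
        induced_norm_scaleR[of "1 - r" "mat 1"] induced_norm_scaleR[of r "mat 1 + t *\<^sub>R M"] r
      by simp
    moreover have "?\<nu> (mat 1 :: real^'n^'n) = 1"
      using induced_norm_mat_1 induced_norm_least[of "mat 1" 1] by simp
    ultimately have "?\<nu> (mat 1 + s *\<^sub>R M) - 1 \<le> r * (?\<nu> (mat 1 + t *\<^sub>R M) - 1)"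
      by (simp add: algebra_simps)
    then have "(?\<nu> (mat 1 + s *\<^sub>R M) - 1) / s \<le> r * (?\<nu> (mat 1 + t *\<^sub>R M) - 1) / s"
      using that by (simp add: divide_right_mono)
    also have "\<dots> = (?\<nu> (mat 1 + t *\<^sub>R M) - 1) / t"
      using that by (simp add: r_def)
    finally show ?thesis
      by (simp add: q_def)
  qed
  \<comment> \<open>Triangle inequality for the identity written as
    \<open>(mat 1 + t *\<^sub>R M) + t *\<^sub>R (- M)\<close>.\<close>
  have bdd: "- ?\<nu> (- M) \<le> q t" if "0 < t" for t
  proof -
    have "1 \<le> ?\<nu> ((mat 1 + t *\<^sub>R M) + t *\<^sub>R (- M))"
      using induced_norm_mat_1 by simp
    also have "\<dots> \<le> ?\<nu> (mat 1 + t *\<^sub>R M) + t * ?\<nu> (- M)"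
      using induced_norm_add[of "mat 1 + t *\<^sub>R M" "t *\<^sub>R (- M)"] induced_norm_scaleR[of t "- M"] that
      by simp
    finally show ?thesis
      using that by (simp add: q_def field_simps)
  qed
  have lim: "(q \<longlongrightarrow> (INF t\<in>{0<..}. q t)) (at_right 0)"
    using mono bdd by (rule tendsto_INF_at_right)
  then have "matrix_measure ?\<nu> M = (INF t\<in>{0<..}. q t)"
    unfolding matrix_measure_def q_def [symmetric] by (intro tendsto_Lim) auto
  then have "\<forall>\<^sub>F h in at_right 0. q h < c"
    using lim assms by (intro order_tendstoD(2)) auto
  then show ?thesis
    using eventually_at_right_less[of 0]
  proof eventually_elim
    case (elim h)
    have "N (y + h *\<^sub>R (M *v y)) = N ((mat 1 + h *\<^sub>R M) *v y)"
      by (simp add: matrix_vector_mult_add_rdistrib scaleR_matrix_vector_assoc)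
    also have "\<dots> \<le> ?\<nu> (mat 1 + h *\<^sub>R M) * N y"
      by (rule induced_norm_bound)
    also have "\<dots> \<le> (1 + c * h) * N y"
      using elim is_norm_nonneg[OF N] by (intro mult_right_mono) (auto simp: q_def field_simps)
    finally show ?case .
  qed
qed

end

subsection \<open>Perron theory of Metzler matrices\<close>

lemma compact_std_simplex: "compact {x :: real^'n. (\<forall>i. 0 \<le> x $ i) \<and> (\<Sum>i\<in>UNIV. x $ i) = 1}"
proof (rule compact_eq_bounded_closed[THEN iffD2], intro conjI)
  show "bounded {x :: real^'n. (\<forall>i. 0 \<le> x $ i) \<and> (\<Sum>i\<in>UNIV. x $ i) = 1}"
  proof (rule boundedI[of _ 1])
    fix x :: "real^'n" assume "x \<in> {x. (\<forall>i. 0 \<le> x $ i) \<and> (\<Sum>i\<in>UNIV. x $ i) = 1}"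
    then show "norm x \<le> 1"
      using norm_le_l1_cart[of x] by simp
  qed
  show "closed {x :: real^'n. (\<forall>i. 0 \<le> x $ i) \<and> (\<Sum>i\<in>UNIV. x $ i) = 1}"
    by (intro closed_Collect_conj closed_Collect_all closed_Collect_le closed_Collect_eq continuous_intros)
qed

text \<open>The Perron vector is a fixed point of the normalised action on the simplex.\<close>

lemma perron_positive:
  fixes P :: "real^'n^'n"
  assumes P: "\<And>i j. 0 < P $ i $ j"
  obtains r v where "\<And>i. 0 < v $ i" "(\<Sum>i\<in>UNIV. v $ i) = 1" "P *v v = r *\<^sub>R v"
proof -
  define S where "S = {x :: real^'n. (\<forall>i. 0 \<le> x $ i) \<and> (\<Sum>i\<in>UNIV. x $ i) = 1}"
  define \<sigma> where "\<sigma> x = (\<Sum>i\<in>UNIV. (P *v x) $ i)" for x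
  have pos: "0 < (P *v x) $ i" if "x \<in> S" for x i
  proof -
    have "\<exists>j. x $ j \<noteq> 0"
    proof (rule ccontr)
      assume "\<nexists>j. x $ j \<noteq> 0"
      then show False
        using that by (simp add: S_def)
    qed
    then obtain j where "x $ j \<noteq> 0"
      by blast
    then have "x $ j > 0"
      using that by (simp add: S_def less_le)
    then have "0 < P $ i $ j * x $ j"
      using P by simp
    also have "\<dots> \<le> (\<Sum>j\<in>UNIV. P $ i $ j * x $ j)"
      using that P by (intro member_le_sum) (auto simp: S_def less_imp_le)
    finally show ?thesis
      by (simp add: matrix_vector_mult_def)
  qed
  have \<sigma>: "\<sigma> x > 0" if "x \<in> S" for x
    unfolding \<sigma>_def using pos[OF that] by (intro sum_pos) auto
  have cont: "continuous_on S (\<lambda>x. P *v x)"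
    by (intro linear_continuous_on matrix_vector_mul_bounded_linear)
  have "\<exists>v\<in>S. (1 / \<sigma> v) *\<^sub>R (P *v v) = v"
  proof (rule brouwer)
    show "compact S"
      unfolding S_def by (rule compact_std_simplex)
    show "convex S"
      unfolding convex_def
    proof (intro ballI allI impI)
      fix x y u w assume "x \<in> S" "y \<in> S" "0 \<le> u" "0 \<le> w" "u + w = (1::real)"
      then show "u *\<^sub>R x + w *\<^sub>R y \<in> S"
        by (simp add: S_def sum.distrib flip: sum_distrib_left)
    qed
    have "axis undefined 1 \<in> S"
      by (simp add: S_def axis_def)
    then show "S \<noteq> {}"
      by blast
    show "continuous_on S (\<lambda>v. (1 / \<sigma> v) *\<^sub>R (P *v v))"
      using \<sigma> unfolding \<sigma>_def
      by (intro continuous_intros cont) (metis less_irrefl)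
    show "(\<lambda>v. (1 / \<sigma> v) *\<^sub>R (P *v v)) \<in> S \<rightarrow> S"
    proof
      fix x assume x: "x \<in> S"
      have "(\<Sum>i\<in>UNIV. (P *v x) $ i / \<sigma> x) = 1"
        using \<sigma>[OF x] by (simp add: \<sigma>_def flip: sum_divide_distrib)
      then show "(1 / \<sigma> x) *\<^sub>R (P *v x) \<in> S"
        using \<sigma>[OF x] pos[OF x] by (simp add: S_def less_imp_le)
    qed
  qed blast
  then obtain v where v: "v \<in> S" "(1 / \<sigma> v) *\<^sub>R (P *v v) = v"
    by blast
  have Pv: "P *v v = \<sigma> v *\<^sub>R v"
  proof -
    have "\<sigma> v *\<^sub>R v = \<sigma> v *\<^sub>R ((1 / \<sigma> v) *\<^sub>R (P *v v))"
      using v(2) by simp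
    then show ?thesis
      using \<sigma>[OF v(1)] by simp
  qed
  show ?thesis
  proof (rule that[OF _ _ Pv])
    show "0 < v $ i" for i
      using pos[OF v(1), of i] \<sigma>[OF v(1)] by (simp add: Pv zero_less_mult_iff)
    show "(\<Sum>i\<in>UNIV. v $ i) = 1"
      using v(1) by (simp add: S_def)
  qed
qed

text \<open>Adding \<delta> to all entries and \<open>k\<close> to the diagonal yields a positive
  matrix. The diagonal shift only moves the eigenvalue by \<open>k\<close>, and the constant matrix
  sends \<open>v\<close> to the constant \<delta> because the entries of \<open>v\<close> sum to
  1.\<close>

lemma metzler_perron_approx:
  assumes B: "metzler B" and \<delta>: "\<delta> > 0"
  obtains r v where "\<And>i. 0 < v $ i" "(\<Sum>i\<in>UNIV. v $ i) = 1" "\<And>i. (B *v v) $ i + \<delta> = r * v $ i"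
proof -
  define k where "k = (\<Sum>i\<in>UNIV. \<bar>B $ i $ i\<bar>)"
  define P where "P = (\<chi> i j. B $ i $ j + \<delta> + (if i = j then k else 0))"
  have "\<bar>B $ i $ i\<bar> \<le> k" for i
    unfolding k_def by (rule member_le_sum) auto
  then have "0 \<le> B $ i $ i + k" for i
    by (smt (verit))
  then have "0 < P $ i $ j" for i j
    using B \<delta> unfolding P_def metzler_def by (cases "i = j") (auto simp: add_pos_nonneg ac_simps)
  then obtain r v where v: "\<And>i. 0 < v $ i" "(\<Sum>i\<in>UNIV. v $ i) = 1" "P *v v = r *\<^sub>R v"
    using perron_positive by blast
  have "(B *v v) $ i + \<delta> = (r - k) * v $ i" for i
  proof -
    have "r * v $ i = (P *v v) $ i"
      using v(3) by simp
    also have "\<dots> = (\<Sum>j\<in>UNIV. B $ i $ j * v $ j + \<delta> * v $ j + (if i = j then k * v $ j else 0))"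
      unfolding P_def matrix_vector_mult_def by (auto intro!: sum.cong simp: algebra_simps)
    also have "\<dots> = (B *v v) $ i + \<delta> * (\<Sum>j\<in>UNIV. v $ j) + k * v $ i"
      by (simp add: sum.distrib matrix_vector_mult_def flip: sum_distrib_left)
    finally show ?thesis
      using v(2) by (simp add: algebra_simps)
  qed
  with v(1,2) show ?thesis
    using that by blast
qed

text \<open>A Gershgorin estimate weighted by \<open>v\<close>: at an index where
  \<open>norm (w $ i) / v $ i\<close> is largest, the eigenvalue equation puts \<open>z\<close> in
  the disc of centre \<open>B $ i $ i\<close> and radius \<open>r - B $ i $ i\<close>.\<close>

lemma metzler_eigenvalue_bound:
  assumes B: "metzler B" and v: "\<And>i. 0 < v $ i" "\<And>i. (B *v v) $ i \<le> r * v $ i"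
    and z: "complex_eigenvalue B z"
  shows "Re z \<le> r"
proof -
  obtain w where w: "w \<noteq> 0" "(\<chi> i j. complex_of_real (B $ i $ j)) *v w = z *s w"
    using z by (auto simp: complex_eigenvalue_def)
  define m where "m = Max (range (\<lambda>i. norm (w $ i) / v $ i))"
  have "m \<in> range (\<lambda>i. norm (w $ i) / v $ i)"
    unfolding m_def by (rule Max_in) auto
  then obtain i where i: "m = norm (w $ i) / v $ i"
    by blast
  have le: "norm (w $ j) \<le> m * v $ j" for j
  proof -
    have "norm (w $ j) / v $ j \<le> m"
      unfolding m_def by (rule Max_ge) auto
    then show ?thesis
      using v(1)[of j] by (simp add: field_simps)
  qed
  have eq: "norm (w $ i) = m * v $ i"
    using i v(1)[of i] by simp
  \<comment> \<open>Needed to cancel \<open>norm (w $ i)\<close> from the final estimate.\<close>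
  have m: "m > 0"
  proof (rule ccontr)
    assume "\<not> m > 0"
    then have "norm (w $ j) \<le> 0" for j
      using le[of j] v(1)[of j] by (meson mult_nonpos_nonneg less_imp_le not_less order_trans)
    then show False
      using w(1) by (simp add: vec_eq_iff)
  qed
  have "(\<Sum>j\<in>UNIV. of_real (B $ i $ j) * w $ j) = z * w $ i"
    using w(2) by (simp add: vec_eq_iff matrix_vector_mult_def)
  then have "(z - of_real (B $ i $ i)) * w $ i = (\<Sum>j\<in>UNIV - {i}. of_real (B $ i $ j) * w $ j)"
    by (subst (asm) sum.remove[of _ i]) (simp_all add: algebra_simps)
  then have "norm (z - of_real (B $ i $ i)) * norm (w $ i)
      = norm (\<Sum>j\<in>UNIV - {i}. of_real (B $ i $ j) * w $ j)"
    by (simp flip: norm_mult)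
  also have "\<dots> \<le> (\<Sum>j\<in>UNIV - {i}. B $ i $ j * (m * v $ j))"
  proof (rule sum_norm_le)
    fix j assume "j \<in> UNIV - {i}"
    then have "0 \<le> B $ i $ j"
      using B by (auto simp: metzler_def)
    then show "norm (of_real (B $ i $ j) * w $ j) \<le> B $ i $ j * (m * v $ j)"
      using le[of j] by (simp add: norm_mult mult_left_mono)
  qed
  also have "\<dots> = m * ((B *v v) $ i - B $ i $ i * v $ i)"
    by (simp add: matrix_vector_mult_def sum.remove[of UNIV i] sum_distrib_left mult_ac)
  also have "\<dots> \<le> m * (r * v $ i - B $ i $ i * v $ i)"
    using m v(2)[of i] by (intro mult_left_mono) auto
  also have "\<dots> = (r - B $ i $ i) * norm (w $ i)"
    by (simp add: eq algebra_simps)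
  finally have "norm (z - of_real (B $ i $ i)) \<le> r - B $ i $ i"
    using eq m v(1)[of i] by simp
  moreover have "Re z - B $ i $ i \<le> norm (z - of_real (B $ i $ i))"
    using complex_Re_le_cmod[of "z - of_real (B $ i $ i)"] by simp
  ultimately show ?thesis
    by simp
qed

text \<open>The Perron roots of the perturbed matrices converge along a subsequence to an eigenvalue
  \<rho> of \<open>B\<close>. Each of them bounds the real parts of all eigenvalues of
  \<open>B\<close>, hence so does \<rho>, which therefore is \<open>lambda_max B\<close>.\<close>

lemma metzler_lambda_max:
  fixes B :: "real^'n^'n"
  assumes B: "metzler B" and c: "lambda_max B < c"
  obtains v \<delta> where "\<And>i. 0 < v $ i" "0 < \<delta>" "(\<Sum>i\<in>UNIV. v $ i) = 1"
    "\<And>i. (B *v v) $ i + \<delta> \<le> c * v $ i"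
proof -
  define d where "d n = inverse (real (Suc n))" for n
  have d: "d n > 0" for n
    by (simp add: d_def)
  have dlim: "d \<longlonglongrightarrow> 0"
    unfolding d_def by (rule LIMSEQ_inverse_real_of_nat)
  have "\<forall>n. \<exists>r v. (\<forall>i. 0 < v $ i) \<and> (\<Sum>i\<in>UNIV. v $ i) = 1 \<and> (\<forall>i. (B *v v) $ i + d n = r * v $ i)"
    using metzler_perron_approx[OF B d] by metis
  then obtain r v where v: "\<And>n i. 0 < v n $ i" "\<And>n. (\<Sum>i\<in>UNIV. v n $ i) = 1"
    and rv: "\<And>n i. (B *v v n) $ i + d n = r n * v n $ i"
    by metis
  \<comment> \<open>Summing the eigenvector equation over the coordinates expresses the root by the
    normalised vector, so convergence of the vectors forces convergence of the roots.\<close>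
  have req: "r n = (\<Sum>i\<in>UNIV. (B *v v n) $ i + d n)" for n
    by (simp add: rv v(2) flip: sum_distrib_left)
  define S where "S = {x :: real^'n. (\<forall>i. 0 \<le> x $ i) \<and> (\<Sum>i\<in>UNIV. x $ i) = 1}"
  have "compact S"
    unfolding S_def by (rule compact_std_simplex)
  moreover have "\<forall>n. v n \<in> S"
    by (simp add: S_def v less_imp_le)
  ultimately obtain u s where u: "u \<in> S" "strict_mono s" "(v \<circ> s) \<longlonglongrightarrow> u"
    unfolding compact_def by blast
  have ds: "(\<lambda>n. d (s n)) \<longlonglongrightarrow> 0"
    using LIMSEQ_subseq_LIMSEQ[OF dlim u(2)] by (simp add: o_def)
  have Bv: "(\<lambda>n. (B *v v (s n)) $ i + d (s n)) \<longlonglongrightarrow> (B *v u) $ i + 0" for i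
    using u(3) unfolding o_def
    by (intro tendsto_intros ds bounded_linear.tendsto[OF matrix_vector_mul_bounded_linear])
  define \<rho> where "\<rho> = (\<Sum>i\<in>UNIV. (B *v u) $ i + 0)"
  have rlim: "(\<lambda>n. r (s n)) \<longlonglongrightarrow> \<rho>"
    unfolding req \<rho>_def by (intro tendsto_sum Bv)
  have "B *v u = \<rho> *\<^sub>R u"
  proof (rule vec_eq_iff[THEN iffD2], rule allI)
    fix i
    have "(\<lambda>n. (B *v v (s n)) $ i + d (s n)) \<longlonglongrightarrow> \<rho> * u $ i"
      unfolding rv using u(3) unfolding o_def by (intro tendsto_intros rlim)
    then show "(B *v u) $ i = (\<rho> *\<^sub>R u) $ i"
      using LIMSEQ_unique[OF Bv] by simp
  qed
  then have Bu: "(\<Sum>j\<in>UNIV. B $ i $ j * u $ j) = \<rho> * u $ i" for i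
    by (simp add: vec_eq_iff matrix_vector_mult_def)
  have "u \<noteq> 0"
    using u(1) by (auto simp: S_def)
  have eig: "complex_eigenvalue B (of_real \<rho>)"
    unfolding complex_eigenvalue_def
  proof (intro exI[of _ "\<chi> i. of_real (u $ i)"] conjI)
    show "(\<chi> i. complex_of_real (u $ i)) \<noteq> 0"
      using \<open>u \<noteq> 0\<close> by (simp add: vec_eq_iff)
    have "(\<Sum>j\<in>UNIV. complex_of_real (B $ i $ j) * of_real (u $ j)) = of_real (\<rho> * u $ i)" for i
      unfolding Bu [symmetric] by simp
    then show "(\<chi> i j. complex_of_real (B $ i $ j)) *v (\<chi> i. of_real (u $ i))
        = of_real \<rho> *s (\<chi> i. of_real (u $ i))"
      by (simp add: vec_eq_iff matrix_vector_mult_def)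
  qed
  have max: "Re z \<le> \<rho>" if z: "complex_eigenvalue B z" for z
  proof (rule LIMSEQ_le_const[OF rlim])
    have "(B *v v (s n)) $ i \<le> r (s n) * v (s n) $ i" for n i
      using rv[of "s n" i] d[of "s n"] by linarith
    then have "Re z \<le> r (s n)" for n
      by (rule metzler_eigenvalue_bound[OF B v(1) _ z])
    then show "\<exists>M. \<forall>n\<ge>M. Re z \<le> r (s n)"
      by blast
  qed
  have "lambda_max B = \<rho>"
    unfolding lambda_max_def
  proof (rule the_equality)
    show "complex_eigenvalue B (of_real \<rho>) \<and> (\<forall>z. complex_eigenvalue B z \<longrightarrow> Re z \<le> \<rho>)"
      using eig max by blast
    fix l assume "complex_eigenvalue B (of_real l) \<and> (\<forall>z. complex_eigenvalue B z \<longrightarrow> Re z \<le> l)"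
    then show "l = \<rho>"
      using eig max[of "of_real l"] by force
  qed
  then have "\<forall>\<^sub>F n in sequentially. r (s n) < c"
    using c by (intro order_tendstoD(2)[OF rlim]) simp
  then obtain n where n: "r (s n) < c"
    using eventually_happens by fastforce
  \<comment> \<open>The vector is taken before the limit: \<open>u\<close> may have zero entries,
    whereas \<open>v (s n)\<close> is strictly positive and its root is already below
    \<open>c\<close>.\<close>
  show ?thesis
  proof (rule that[OF v(1) d v(2)])
    show "(B *v v (s n)) $ i + d (s n) \<le> c * v (s n) $ i" for i
      unfolding rv using n v(1)[of "s n" i] by simp
  qed
qed

section \<open>The weighted maximum norm and its infinitesimal growth\<close>

definition weighted_max_norm :: "real^'n \<Rightarrow> real^'n \<Rightarrow> real" where
  "weighted_max_norm v x = Max (range (\<lambda>i. \<bar>x $ i\<bar> / v $ i))"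

lemma weighted_max_norm_ge: "0 < v $ i \<Longrightarrow> \<bar>x $ i\<bar> \<le> weighted_max_norm v x * v $ i"
proof -
  assume "0 < v $ i"
  moreover have "\<bar>x $ i\<bar> / v $ i \<le> weighted_max_norm v x"
    unfolding weighted_max_norm_def by (rule Max_ge) auto
  ultimately show ?thesis
    by (simp add: field_simps)
qed

lemma weighted_max_norm_le:
  assumes "\<And>i. 0 < v $ i" "\<And>i. \<bar>x $ i\<bar> \<le> C * v $ i"
  shows "weighted_max_norm v x \<le> C"
proof -
  have "\<bar>x $ i\<bar> / v $ i \<le> C" for i
    using assms[of i] by (simp add: field_simps)
  then show ?thesis
    unfolding weighted_max_norm_def by (subst Max_le_iff) auto
qed

lemma is_norm_weighted_max_norm:
  fixes v :: "real^'n"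
  assumes v: "\<And>i. 0 < v $ i"
  shows "is_norm (weighted_max_norm v)"
proof -
  have nonneg: "0 \<le> weighted_max_norm v x" for x
    using weighted_max_norm_ge[OF v[of undefined], of x] v[of undefined]
    by (metis abs_ge_zero order_trans zero_le_mult_iff not_less)
  have scale_le: "weighted_max_norm v (c *\<^sub>R x) \<le> \<bar>c\<bar> * weighted_max_norm v x" for c x
    by (rule weighted_max_norm_le[OF v])
      (simp add: abs_mult mult.assoc mult_left_mono weighted_max_norm_ge[OF v])
  have scale: "weighted_max_norm v (c *\<^sub>R x) = \<bar>c\<bar> * weighted_max_norm v x" for c x
  proof (cases "c = 0")
    case True
    then show ?thesis
      using scale_le[of c x] nonneg[of "c *\<^sub>R x"] by simp
  next
    case False
    then have "\<bar>c\<bar> * weighted_max_norm v x \<le> weighted_max_norm v (c *\<^sub>R x)"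
      using scale_le[of "1 / c" "c *\<^sub>R x"] by (simp add: abs_divide field_simps)
    then show ?thesis
      using scale_le[of c x] by simp
  qed
  have zero: "x = 0" if "weighted_max_norm v x = 0" for x
    using weighted_max_norm_ge[OF v, of x] that by (simp add: vec_eq_iff)
  have triangle: "weighted_max_norm v (x + y) \<le> weighted_max_norm v x + weighted_max_norm v y" for x y
  proof (rule weighted_max_norm_le[OF v])
    fix i
    show "\<bar>(x + y) $ i\<bar> \<le> (weighted_max_norm v x + weighted_max_norm v y) * v $ i"
      using weighted_max_norm_ge[OF v, of x i] weighted_max_norm_ge[OF v, of y i]
      by (simp add: distrib_right)
  qed
  have "weighted_max_norm v 0 = 0"
    using scale[of 0 0] by simp
  then show ?thesis
    unfolding is_norm_def using nonneg scale zero triangle by blast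
qed

text \<open>The row condition is the explicit form of the matrix measure of this norm being at most
  \<open>c\<close>. For small \<open>h\<close> the factor \<open>1 + h * M $ i $ i\<close> is
  positive, which is why the diagonal entries enter with their sign and only the others in absolute
  value.\<close>

lemma weighted_max_norm_log_norm:
  fixes M :: "real^'n^'n"
  assumes v: "\<And>i. 0 < v $ i"
    and M: "\<And>i. M $ i $ i * v $ i + (\<Sum>j\<in>UNIV - {i}. \<bar>M $ i $ j\<bar> * v $ j) \<le> c * v $ i"
  shows "\<forall>\<^sub>F h in at_right 0.
    weighted_max_norm v (y + h *\<^sub>R (M *v y)) \<le> (1 + c * h) * weighted_max_norm v y"
proof -
  have "\<forall>\<^sub>F h in at_right 0. 0 < 1 + h * M $ i $ i" for i
  proof (rule order_tendstoD(1))
    show "((\<lambda>h. 1 + h * M $ i $ i) \<longlongrightarrow> 1 + 0 * M $ i $ i) (at_right 0)"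
      by (intro tendsto_intros)
  qed simp
  then have "\<forall>\<^sub>F h in at_right 0. \<forall>i. 0 < 1 + h * M $ i $ i"
    by (rule eventually_all_finite)
  then show ?thesis
    using eventually_at_right_less[of 0]
  proof eventually_elim
    case (elim h)
    define m where "m = weighted_max_norm v y"
    have m: "m \<ge> 0"
      unfolding m_def by (rule is_norm_nonneg[OF is_norm_weighted_max_norm[OF v]])
    have y: "\<bar>y $ j\<bar> \<le> m * v $ j" for j
      unfolding m_def by (rule weighted_max_norm_ge[OF v])
    show ?case
    proof (rule weighted_max_norm_le[OF v])
      fix i
      let ?s = "\<Sum>j\<in>UNIV - {i}. M $ i $ j * y $ j"
      have "(y + h *\<^sub>R (M *v y)) $ i = (1 + h * M $ i $ i) * y $ i + h * ?s"
        by (simp add: matrix_vector_mult_def sum.remove[of UNIV i] algebra_simps)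
      then have "\<bar>(y + h *\<^sub>R (M *v y)) $ i\<bar> \<le> \<bar>(1 + h * M $ i $ i) * y $ i\<bar> + \<bar>h * ?s\<bar>"
        by simp
      also have "\<dots> = (1 + h * M $ i $ i) * \<bar>y $ i\<bar> + h * \<bar>?s\<bar>"
        using elim by (simp add: abs_mult less_imp_le)
      also have "\<dots> \<le> (1 + h * M $ i $ i) * (m * v $ i) + h * (\<Sum>j\<in>UNIV - {i}. \<bar>M $ i $ j\<bar> * (m * v $ j))"
      proof (intro add_mono mult_left_mono y)
        have "\<bar>?s\<bar> \<le> (\<Sum>j\<in>UNIV - {i}. \<bar>M $ i $ j * y $ j\<bar>)"
          by (rule sum_abs)
        also have "\<dots> \<le> (\<Sum>j\<in>UNIV - {i}. \<bar>M $ i $ j\<bar> * (m * v $ j))"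
          by (intro sum_mono) (simp add: abs_mult mult_left_mono y)
        finally show "\<bar>?s\<bar> \<le> (\<Sum>j\<in>UNIV - {i}. \<bar>M $ i $ j\<bar> * (m * v $ j))" .
      qed (use elim in \<open>auto intro: less_imp_le\<close>)
      also have "\<dots> = m * v $ i + h * m * (M $ i $ i * v $ i + (\<Sum>j\<in>UNIV - {i}. \<bar>M $ i $ j\<bar> * v $ j))"
        by (simp add: algebra_simps sum_distrib_left)
      also have "\<dots> \<le> m * v $ i + h * m * (c * v $ i)"
        using elim m by (intro add_left_mono mult_left_mono M) auto
      also have "\<dots> = (1 + c * h) * m * v $ i"
        by (simp add: algebra_simps)
      finally show "\<bar>(y + h *\<^sub>R (M *v y)) $ i\<bar> \<le> (1 + c * h) * weighted_max_norm v y * v $ i"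
        by (simp add: m_def)
    qed
  qed
qed

subsection \<open>The entropy bounds\<close>

text \<open>The number \<delta> is used twice. Eventually the entries of \<open>A t\<close> lie
  below those of \<open>B\<close> plus \<delta>, and this excess contributes exactly \<delta> to
  each row because the weights sum to 1; the hypothesis on \<open>v\<close> has room for it.\<close>

lemma limsup_bound_log_norm:
  fixes A :: "real \<Rightarrow> real^'n^'n"
  assumes v: "\<And>i. 0 < v $ i" "0 < \<delta>" "(\<Sum>i\<in>UNIV. v $ i) = 1" "\<And>i. (B *v v) $ i + \<delta> \<le> c * v $ i"
    and diag: "\<And>i. Limsup at_top (\<lambda>t. ereal (A t $ i $ i)) \<le> ereal (B $ i $ i)"
    and offdiag: "\<And>i j. i \<noteq> j \<Longrightarrow> Limsup at_top (\<lambda>t. ereal \<bar>A t $ i $ j\<bar>) \<le> ereal (B $ i $ j)"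
  shows "\<forall>\<^sub>F t in at_top. \<forall>y. \<forall>\<^sub>F h in at_right 0.
    weighted_max_norm v (y + h *\<^sub>R (A t *v y)) \<le> (1 + c * h) * weighted_max_norm v y"
proof -
  have less: "\<forall>\<^sub>F t in at_top. f t < b + \<delta>" if "Limsup at_top (\<lambda>t. ereal (f t)) \<le> ereal b"
    for f :: "real \<Rightarrow> real" and b
  proof -
    have "Limsup at_top (\<lambda>t. ereal (f t)) < ereal (b + \<delta>)"
      using that v(2) by (auto elim: le_less_trans)
    then show ?thesis
      using Limsup_lessD[of at_top "\<lambda>t. ereal (f t)" "ereal (b + \<delta>)"] by simp
  qed
  have "\<forall>\<^sub>F t in at_top. (if i = j then A t $ i $ j else \<bar>A t $ i $ j\<bar>) < B $ i $ j + \<delta>" for i j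
    using less[OF diag[of i]] less[OF offdiag[of i j]] by (cases "i = j") simp_all
  then have "\<forall>\<^sub>F t in at_top. \<forall>i j. (if i = j then A t $ i $ j else \<bar>A t $ i $ j\<bar>) < B $ i $ j + \<delta>"
    by (intro eventually_all_finite)
  then show ?thesis
  proof eventually_elim
    case (elim t)
    show ?case
    proof (intro allI weighted_max_norm_log_norm v(1))
      fix i
      have "A t $ i $ i * v $ i + (\<Sum>j\<in>UNIV - {i}. \<bar>A t $ i $ j\<bar> * v $ j)
          = (\<Sum>j\<in>UNIV. (if i = j then A t $ i $ j else \<bar>A t $ i $ j\<bar>) * v $ j)"
        by (simp add: sum.remove[of UNIV i])
      also have "\<dots> \<le> (\<Sum>j\<in>UNIV. (B $ i $ j + \<delta>) * v $ j)"
        by (intro sum_mono mult_right_mono less_imp_le[OF elim[rule_format]] less_imp_le[OF v(1)])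
      also have "\<dots> = (B *v v) $ i + \<delta>"
        by (simp add: matrix_vector_mult_def distrib_right sum.distrib v(3) flip: sum_distrib_left)
      also have "\<dots> \<le> c * v $ i"
        by (rule v(4))
      finally show "A t $ i $ i * v $ i + (\<Sum>j\<in>UNIV - {i}. \<bar>A t $ i $ j\<bar> * v $ j) \<le> c * v $ i" .
    qed
  qed
qed

text \<open>Lets \<open>c\<close> decrease to \<open>m\<close>, which recovers the stated bound from
  those with \<open>c\<close> strictly larger.\<close>

lemma ereal_le_mult_limit:
  assumes n: "0 < n" and le: "\<And>c. m < c \<Longrightarrow> x \<le> ereal (n * c)"
  shows "x \<le> ereal (n * m)"
proof (rule ereal_le_epsilon2)
  fix e :: real assume "0 < e"
  then have "x \<le> ereal (n * (m + e / n))"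
    using n by (intro le) simp
  then show "x \<le> ereal (n * m) + ereal e"
    using n by (simp add: distrib_left)
qed

theorem corollary1:
  fixes A :: "real \<Rightarrow> real^'n^'n"
    and t0 :: real
    and N :: "real^'n \<Rightarrow> real"
    and K :: "(real^'n) set"
    and N' :: "real^'n \<Rightarrow> real"
  assumes "piecewise_continuous A"
    and "is_norm N"
    and "compact K" and "interior K \<noteq> {}"
    and "is_norm N'"
  shows
    "topological_entropy N K t0 A
       \<le> ereal (real CARD('n)) *
           max (Limsup at_top (\<lambda>t. ereal (matrix_measure (induced_norm N') (A t)))) 0
     \<and> topological_entropy N K t0 A
       \<ge> max (Liminf at_top (\<lambda>t. ereal (trace (A t)))) 0
     \<and> (\<forall>B :: real^'n^'n.
          metzler B \<and>
          (\<forall>i. ereal (B $ i $ i) \<ge> Limsup at_top (\<lambda>t. ereal (A t $ i $ i))) \<and>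
          (\<forall>i j. i \<noteq> j \<longrightarrow> ereal (B $ i $ j) \<ge> Limsup at_top (\<lambda>t. ereal \<bar>A t $ i $ j\<bar>))
          \<longrightarrow> topological_entropy N K t0 A
              \<le> ereal (real CARD('n) * max (lambda_max B) 0))"
proof (intro conjI allI impI)
  let ?h = "topological_entropy N K t0 A"
  let ?\<mu> = "\<lambda>t. matrix_measure (induced_norm N') (A t)"
  note le_log_norm = topological_entropy_le_log_norm[OF assms(1-4)]
  have n: "0 < real CARD('n)"
    by simp
  define m where "m = max (Limsup at_top (\<lambda>t. ereal (?\<mu> t))) 0"
  have "?h \<le> ereal (real CARD('n)) * m"
  \<comment> \<open>An infinite limsup makes the right-hand side infinite; the value minus infinity
    is excluded by the maximum with 0.\<close>
  proof (cases m)
    case (real r)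
    have "?h \<le> ereal (real CARD('n) * r)"
    proof (rule ereal_le_mult_limit[OF n])
      fix c assume c: "r < c"
      have "0 \<le> m"
        by (simp add: m_def)
      then have c0: "0 \<le> c"
        using c real by simp
      have "Limsup at_top (\<lambda>t. ereal (?\<mu> t)) \<le> m"
        by (simp add: m_def)
      then have "Limsup at_top (\<lambda>t. ereal (?\<mu> t)) < ereal c"
        using c real by (auto elim: le_less_trans)
      then have "\<forall>\<^sub>F t in at_top. ?\<mu> t < c"
        using Limsup_lessD[of at_top "\<lambda>t. ereal (?\<mu> t)" "ereal c"] by simp
      then have "\<forall>\<^sub>F t in at_top. \<forall>y. \<forall>\<^sub>F h in at_right 0. N' (y + h *\<^sub>R (A t *v y)) \<le> (1 + c * h) * N' y"
        by eventually_elim (use matrix_measure_log_norm[OF assms(5)] in blast)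
      then show "?h \<le> ereal (real CARD('n) * c)"
        by (rule le_log_norm[OF assms(5) c0])
    qed
    then show ?thesis
      using real by simp
  next
    case PInf
    then show ?thesis
      by simp
  next
    case MInf
    then show ?thesis
      by (simp add: m_def max_def split: if_splits)
  qed
  then show "?h \<le> ereal (real CARD('n)) * max (Limsup at_top (\<lambda>t. ereal (?\<mu> t))) 0"
    by (simp add: m_def)
  have "Liminf at_top (\<lambda>t. ereal (trace (A t))) \<le> ?h"
  \<comment> \<open>Testing against all smaller \<open>z\<close> also handles an infinite liminf,
    since only finite \<open>z\<close> require an argument.\<close>
  proof (rule dense_le)
    fix z assume z: "z < Liminf at_top (\<lambda>t. ereal (trace (A t)))"
    show "z \<le> ?h"
    proof (cases z)
      case (real r)
      then have "\<forall>\<^sub>F t in at_top. r < trace (A t)"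
        using less_LiminfD[OF z] by simp
      then have "\<forall>\<^sub>F t in at_top. r \<le> trace (A t)"
        by eventually_elim simp
      then show ?thesis
        unfolding real by (rule topological_entropy_ge_trace[OF assms(1-4)])
    qed (use z in auto)
  qed
  then show "?h \<ge> max (Liminf at_top (\<lambda>t. ereal (trace (A t)))) 0"
    using topological_entropy_nonneg[OF assms(1-4)] by simp
  fix B :: "real^'n^'n"
  assume B: "metzler B \<and>
      (\<forall>i. ereal (B $ i $ i) \<ge> Limsup at_top (\<lambda>t. ereal (A t $ i $ i))) \<and>
      (\<forall>i j. i \<noteq> j \<longrightarrow> ereal (B $ i $ j) \<ge> Limsup at_top (\<lambda>t. ereal \<bar>A t $ i $ j\<bar>))"
  show "?h \<le> ereal (real CARD('n) * max (lambda_max B) 0)"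
  proof (rule ereal_le_mult_limit[OF n])
    \<comment> \<open>A \<open>c\<close> above the maximum is both above
      \<open>lambda_max B\<close>, which supplies the weights, and nonnegative, as the grid argument
      requires.\<close>
    fix c assume c: "max (lambda_max B) 0 < c"
    obtain v \<delta> where v: "\<And>i. 0 < v $ i" "0 < \<delta>" "(\<Sum>i\<in>UNIV. v $ i) = 1"
      "\<And>i. (B *v v) $ i + \<delta> \<le> c * v $ i"
      using metzler_lambda_max[of B c] B c by auto
    have "\<forall>\<^sub>F t in at_top. \<forall>y. \<forall>\<^sub>F h in at_right 0.
        weighted_max_norm v (y + h *\<^sub>R (A t *v y)) \<le> (1 + c * h) * weighted_max_norm v y"
      by (rule limsup_bound_log_norm[OF v]) (use B in auto)
    then show "?h \<le> ereal (real CARD('n) * c)"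
      using c by (intro le_log_norm[OF is_norm_weighted_max_norm[OF v(1)]]) auto
  qed
qed

end
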